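(* Let $(U_k)_{k\ge1}$ be i.i.d. almost surely positive random variables distributed as $U$, with tail function $Q(x)=\mathbb{P}(U>x)$, and assume: the maximum of the support of the distribution of $U$ is $1$ and there exists $\alpha\in[0,2)$ such that $\log Q(1-u)=\alpha\log u+o(\log u)$ as $u\to0^+$. Let $(v_{N+1})_{N\ge1}$ be a deterministic sequence of positive reals. For each $N$, let $V_1\le\dots\le V_N$ be the order statistics of $(U_1,\dots,U_N)$ and, conditionally on $(V_1,\dots,V_N)$, let $(X_{i,j})_{1\le i<j\le N+1}$ be independent Bernoulli variables with $\mathbb{P}_V(X_{i,j}=1)=\frac{V_i}{V_i+V_j}$, where $V_{N+1}:=v_{N+1}$; set $X_{j,i}=1-X_{i,j}$ and $S_i=\sum_{j=1,\,j\ne i}^{N}X_{i,j}$ for $i\in\{1,\dots,N+1\}$ (so the total score of player $i\le N$ is $S_i+X_{i,N+1}$ and that of player $N+1$ is $S_{N+1}$). Let \[\vartheta_U=\mathbb{E}\Big[\frac{U}{(U+1)^2}\Big],\qquad \epsilon_N=\sqrt{\frac{2-\alpha}{\vartheta_U}\,\frac{\log N}{N}}.\] (i) If $\liminf_{N\to\infty}\frac{v_{N+1}-1}{\epsilon_N}>1$, then $\mathbb{P}$-almost surely \[\mathbb{P}_V(\text{player } N+1 \text{ wins})\ \ge\ \mathbb{P}_V\Big(S_{N+1}>1+\max_{1\le i\le N}S_i\Big)\xrightarrow[N\to\infty]{}1.\] (ii) If $\limsup_{N\to\infty}\frac{v_{N+1}-1}{\epsilon_N}<1$, then $\mathbb{P}$-almost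 surely \[\mathbb{P}_V(\text{player } N+1 \text{ does not win})\ \ge\ \mathbb{P}_V\Big(S_{N+1}<\max_{1\le i\le N}S_i\Big)\xrightarrow[N\to\infty]{}1.\]
   Context: $\mathbb{P}$ is the annealed probability and $\mathbb{P}_V$ the quenched probability given $(V_1,\dots,V_N)$. $X_{i,j}=1$ means player $i$ beats player $j$. "Player $N+1$ wins" means his total score $S_{N+1}$ is at least the total score $S_i+X_{i,N+1}$ of every other player $i\le N$. *)

theory Defs
  imports "HOL-Probability.Probability" "HOL-Library.Landau_Symbols"
begin

definition dist_support :: "real measure \<Rightarrow> real set" where
  "dist_support D = {x. \<forall>e>0. measure D (ball x e) > 0}"

definition order_stat :: "nat \<Rightarrow> (nat \<Rightarrow> real) \<Rightarrow> nat \<Rightarrow> real" where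
  "order_stat N w k = sort (map w [1..<N+1]) ! (k - 1)"

definition strengths :: "nat \<Rightarrow> (nat \<Rightarrow> real) \<Rightarrow> real \<Rightarrow> nat \<Rightarrow> real" where
  "strengths N w vN1 k = (if k \<le> N then order_stat N w k else vN1)"

definition pairs :: "nat \<Rightarrow> (nat \<times> nat) set" where
  "pairs N = {(i,j). 1 \<le> i \<and> i < j \<and> j \<le> N+1}"

(* Quenched law of the tournament given strengths V: independent Bernoulli
   variables for the pairs i<j, with x(i,j) = True meaning player i beats j,
   with probability V_i/(V_i+V_j). *)
definition tournament :: "nat \<Rightarrow> (nat \<Rightarrow> real) \<Rightarrow> (nat \<times> nat \<Rightarrow> bool) pmf" where
  "tournament N V = Pi_pmf (pairs N) False
      (\<lambda>(i,j). bernoulli_pmf (V i / (V i + V j)))"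

definition Xres :: "(nat \<times> nat \<Rightarrow> bool) \<Rightarrow> nat \<Rightarrow> nat \<Rightarrow> nat" where
  "Xres x i j = (if i < j then (if x (i,j) then 1 else 0)
                 else if j < i then (if x (j,i) then 0 else 1) else 0)"

definition score :: "nat \<Rightarrow> (nat \<times> nat \<Rightarrow> bool) \<Rightarrow> nat \<Rightarrow> nat" where
  "score N x i = (\<Sum>j\<in>{1..N} - {i}. Xres x i j)"

definition last_wins :: "nat \<Rightarrow> (nat \<times> nat \<Rightarrow> bool) \<Rightarrow> bool" where
  "last_wins N x = (\<forall>i\<in>{1..N}. score N x (N+1) \<ge> score N x i + Xres x i (N+1))"

definition qprob :: "nat \<Rightarrow> (nat \<Rightarrow> real) \<Rightarrow> real \<Rightarrow> ((nat \<times> nat \<Rightarrow> bool) \<Rightarrow> bool) \<Rightarrow> real" where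
  "qprob N w vN1 E = measure_pmf.prob (tournament N (strengths N w vN1)) {x. E x}"

end

theory Submission
  imports Defs "HOL-Real_Asymp.Real_Asymp"
begin

text \<open>
  Against the field, a player of strength \<open>x\<close> has mean score \<open>F x = (\<Sum>j. x / (x + V j))\<close>, whose
  derivative at \<open>1\<close> is asymptotic to \<open>N \<theta>\<close>; the same quantity is the variance of the score of a player
  of strength close to \<open>1\<close>. The scale \<open>\<epsilon> N\<close> is therefore the one at which a deviation of size
  \<open>\<epsilon> N * N \<theta>\<close> has probability \<open>N powr (- (2 - \<alpha>) / 2)\<close>, while about \<open>N powr ((2 - \<alpha>) / 2)\<close> players
  have strength within \<open>O(\<epsilon> N)\<close> of \<open>1\<close>. The score of player \<open>N + 1\<close> concentrates around
  \<open>F 1 + (v (N+1) - 1) * N \<theta>\<close>.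

  In case (i) a sharp Chernoff bound for the players near \<open>1\<close> and Hoeffding's inequality for
  the others give, by a union bound, that nobody reaches the score of player \<open>N + 1\<close>. In case (ii) one takes a
  set \<open>A\<close> of \<open>N powr \<beta>\<close> players near \<open>1\<close> with \<open>\<beta>\<close> slightly below \<open>(2 - \<alpha>) / 2\<close>: their results against
  players outside \<open>A\<close> are independent, and a matching lower bound on the deviation probability shows
  that one of them exceeds the score of player \<open>N + 1\<close>. Since \<open>\<beta> < 1\<close>, the games inside \<open>A\<close> only
  contribute fluctuations of smaller order.
\<close>

subsection \<open>Sums of independent Bernoulli variables\<close>

text \<open>The third-order Maclaurin remainder is at most \<open>\<bar>y\<bar> ^ 3 / 2\<close>
  because e is at most 3. Keeping the factor 1/2 of the quadratic term is what later preserves the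
  sharp constant in \<epsilon>.\<close>

lemma exp_quadratic_bounds:
  fixes y :: real
  assumes "\<bar>y\<bar> \<le> 1"
  shows "exp y \<le> 1 + y + y\<^sup>2 / 2 * (1 + \<bar>y\<bar>)" "1 + y + y\<^sup>2 / 2 * (1 - \<bar>y\<bar>) \<le> exp y"
proof -
  obtain t where t: "\<bar>t\<bar> \<le> \<bar>y\<bar>" "exp y = (\<Sum>m<3. y ^ m / fact m) + exp t / fact 3 * y ^ 3"
    using Maclaurin_exp_le[of y 3] by blast
  have "exp t \<le> exp 1"
    using t assms by (subst exp_le_cancel_iff) linarith
  then have "exp t / 6 \<le> 1 / 2"
    using exp_le by linarith
  then have "\<bar>exp t / 6 * y ^ 3\<bar> \<le> 1 / 2 * \<bar>y\<bar> ^ 3"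
    unfolding abs_mult power_abs[symmetric] by (intro mult_right_mono) auto
  moreover have "exp y = 1 + y + y\<^sup>2 / 2 + exp t / 6 * y ^ 3"
    using t(2) by (simp add: eval_nat_numeral)
  moreover have "\<bar>y\<bar> ^ 3 = y\<^sup>2 * \<bar>y\<bar>"
    by (simp add: power3_eq_cube power2_eq_square)
  ultimately show "exp y \<le> 1 + y + y\<^sup>2 / 2 * (1 + \<bar>y\<bar>)" "1 + y + y\<^sup>2 / 2 * (1 - \<bar>y\<bar>) \<le> exp y"
    by (simp_all add: algebra_simps abs_le_iff)
qed

text \<open>Averaging the quadratic bound over both outcomes cancels the linear terms by centering,
  and the squares add up to the variance \<open>p * (1 - p)\<close>. A range-based bound would
  replace the variance by 1/4 and lose the exact threshold.\<close>

lemma centered_bernoulli_mgf_le: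
  fixes p l :: real
  assumes p: "0 \<le> p" "p \<le> 1" and l: "\<bar>l\<bar> \<le> 1"
  shows "p * exp (l * (1 - p)) + (1 - p) * exp (- l * p) \<le> exp (l\<^sup>2 / 2 * (1 + \<bar>l\<bar>) * (p * (1 - p)))"
proof -
  have e: "exp (l * c) \<le> 1 + l * c + (l * c)\<^sup>2 / 2 * (1 + \<bar>l\<bar>)" if "\<bar>c\<bar> \<le> 1" for c
  proof -
    have "\<bar>l * c\<bar> \<le> \<bar>l\<bar>"
      using that by (simp add: abs_mult mult_left_le)
    then have "(l * c)\<^sup>2 / 2 * (1 + \<bar>l * c\<bar>) \<le> (l * c)\<^sup>2 / 2 * (1 + \<bar>l\<bar>)"
      by (intro mult_left_mono) auto
    with exp_quadratic_bounds(1)[of "l * c"] \<open>\<bar>l * c\<bar> \<le> \<bar>l\<bar>\<close> l show ?thesis by linarith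
  qed
  have "p * exp (l * (1 - p)) + (1 - p) * exp (l * (- p))
      \<le> p * (1 + l * (1 - p) + (l * (1 - p))\<^sup>2 / 2 * (1 + \<bar>l\<bar>))
        + (1 - p) * (1 + l * (- p) + (l * (- p))\<^sup>2 / 2 * (1 + \<bar>l\<bar>))"
    using p by (intro add_mono mult_left_mono e) auto
  also have "\<dots> = 1 + l\<^sup>2 / 2 * (1 + \<bar>l\<bar>) * (p * (1 - p))"
    by (simp add: power2_eq_square field_simps)
  also have "\<dots> \<le> exp (l\<^sup>2 / 2 * (1 + \<bar>l\<bar>) * (p * (1 - p)))"
    by (rule exp_ge_add_one_self)
  finally show ?thesis by simp
qed

text \<open>The same averaging gives \<open>1 + z\<close> with \<open>z\<close> the damped variance
  term. Returning to an exponential by \<open>ln (1 + z) >= z - z^2\<close> costs a factor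
  \<open>1 - z\<close>, and \<open>z <= l\<close> turns \<open>(1 - l) * (1 - z)\<close> into at
  least \<open>1 - 2 * l\<close>.\<close>

lemma centered_bernoulli_mgf_ge:
  fixes p l :: real
  assumes p: "0 \<le> p" "p \<le> 1" and l: "0 \<le> l" "l \<le> 1"
  shows "exp (l\<^sup>2 / 2 * (1 - 2 * l) * (p * (1 - p))) \<le> p * exp (l * (1 - p)) + (1 - p) * exp (- l * p)"
proof -
  have e: "1 + l * c + (l * c)\<^sup>2 / 2 * (1 - l) \<le> exp (l * c)" if "\<bar>c\<bar> \<le> 1" for c
  proof -
    have "\<bar>l * c\<bar> \<le> l"
      using that l by (simp add: abs_mult mult_left_le)
    then have "(l * c)\<^sup>2 / 2 * (1 - l) \<le> (l * c)\<^sup>2 / 2 * (1 - \<bar>l * c\<bar>)"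
      by (intro mult_left_mono) auto
    with exp_quadratic_bounds(2)[of "l * c"] \<open>\<bar>l * c\<bar> \<le> l\<close> l show ?thesis by linarith
  qed
  define q where "q = p * (1 - p)"
  define z where "z = l\<^sup>2 / 2 * (1 - l) * q"
  have q: "0 \<le> q" "q \<le> 1"
    using p by (auto simp: q_def mult_le_one)
  have "l\<^sup>2 \<le> l"
    using l by (simp add: power2_eq_square mult_left_le)
  have z0: "0 \<le> z"
    using l q by (simp add: z_def)
  have "z \<le> l\<^sup>2 / 2 * 1 * 1"
    unfolding z_def using l q by (intro mult_mono) auto
  then have zl: "z \<le> l" using \<open>l\<^sup>2 \<le> l\<close> l by simp
  have "l\<^sup>2 / 2 * (1 - 2 * l) * q \<le> l\<^sup>2 / 2 * ((1 - l) * (1 - z)) * q"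
  proof (intro mult_right_mono mult_left_mono)
    show "1 - 2 * l \<le> (1 - l) * (1 - z)"
      using zl mult_nonneg_nonneg[OF l(1) z0] by (simp add: algebra_simps)
  qed (use q in auto)
  also have "\<dots> = z - z\<^sup>2"
    by (simp add: z_def power2_eq_square field_simps)
  also have "\<dots> \<le> ln (1 + z)"
    using z0 zl l by (intro ln_one_plus_pos_lower_bound) auto
  finally have "exp (l\<^sup>2 / 2 * (1 - 2 * l) * q) \<le> exp (ln (1 + z))"
    by simp
  also have "\<dots> = 1 + z"
    using z0 by simp
  also have "\<dots> = p * (1 + l * (1 - p) + (l * (1 - p))\<^sup>2 / 2 * (1 - l))
        + (1 - p) * (1 + l * (- p) + (l * (- p))\<^sup>2 / 2 * (1 - l))"
    unfolding z_def q_def by (simp add: power2_eq_square field_simps)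
  also have "\<dots> \<le> p * exp (l * (1 - p)) + (1 - p) * exp (l * (- p))"
    using p by (intro add_mono mult_left_mono e) auto
  finally show ?thesis by (simp add: q_def)
qed

text \<open>Stated over a general probability space because it serves twice: for the games of one
  player under the quenched law, with differing success probabilities, and for the number of strong
  players in the random sample.\<close>

locale indep_bernoulli = prob_space +
  fixes I :: "'b set" and X :: "'b \<Rightarrow> 'a \<Rightarrow> real" and p :: "'b \<Rightarrow> real"
  assumes fin: "finite I"
    and indep: "indep_vars (\<lambda>_. borel) X I"
    and X01: "\<And>i \<omega>. i \<in> I \<Longrightarrow> \<omega> \<in> space M \<Longrightarrow> X i \<omega> = 0 \<or> X i \<omega> = 1"
    and prob_X: "\<And>i. i \<in> I \<Longrightarrow> prob {\<omega> \<in> space M. X i \<omega> = 1} = p i"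
begin

lemma X_measurable [measurable]: "i \<in> I \<Longrightarrow> X i \<in> borel_measurable M"
  using indep unfolding indep_vars_def by blast

lemma p_bounds: "i \<in> I \<Longrightarrow> 0 \<le> p i" "i \<in> I \<Longrightarrow> p i \<le> 1"
  by (simp_all flip: prob_X)

lemma expectation_fun_X:
  assumes i: "i \<in> I"
  shows "integrable M (\<lambda>\<omega>. f (X i \<omega>) :: real)"
    and "expectation (\<lambda>\<omega>. f (X i \<omega>)) = p i * f 1 + (1 - p i) * f 0"
proof -
  note [measurable] = X_measurable[OF i]
  define A where "A = {\<omega> \<in> space M. X i \<omega> = 1}"
  have [measurable]: "A \<in> sets M" unfolding A_def by measurable
  have eq: "f (X i \<omega>) = f 0 + (f 1 - f 0) * indicator A \<omega>" if "\<omega> \<in> space M" for \<omega>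
    using X01[OF i that] that by (auto simp: A_def)
  have "integrable M (\<lambda>\<omega>. f 0 + (f 1 - f 0) * indicator A \<omega>)"
    by (intro Bochner_Integration.integrable_add integrable_const integrable_mult_right)
       (simp add: emeasure_eq_measure)
  then show int: "integrable M (\<lambda>\<omega>. f (X i \<omega>))"
    by (subst Bochner_Integration.integrable_cong[OF refl eq]) auto
  have "expectation (\<lambda>\<omega>. f (X i \<omega>)) = expectation (\<lambda>\<omega>. f 0 + (f 1 - f 0) * indicator A \<omega>)"
    by (intro Bochner_Integration.integral_cong eq) auto
  also have "\<dots> = f 0 + (f 1 - f 0) * prob A"
    by (subst Bochner_Integration.integral_add) (auto simp: emeasure_eq_measure prob_space)
  finally show "expectation (\<lambda>\<omega>. f (X i \<omega>)) = p i * f 1 + (1 - p i) * f 0"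
    using prob_X[OF i] by (simp add: A_def algebra_simps)
qed

lemma mgf_eq:
  shows "integrable M (\<lambda>\<omega>. exp (l * ((\<Sum>i\<in>I. X i \<omega>) - (\<Sum>i\<in>I. p i))))"
    and "expectation (\<lambda>\<omega>. exp (l * ((\<Sum>i\<in>I. X i \<omega>) - (\<Sum>i\<in>I. p i))))
      = (\<Prod>i\<in>I. p i * exp (l * (1 - p i)) + (1 - p i) * exp (- l * p i))"
proof -
  have eq: "exp (l * ((\<Sum>i\<in>I. X i \<omega>) - (\<Sum>i\<in>I. p i))) = (\<Prod>i\<in>I. exp (l * (X i \<omega> - p i)))" for \<omega>
    by (simp add: exp_sum[OF fin, symmetric] sum_distrib_left sum_subtractf right_diff_distrib)
  have ind: "indep_vars (\<lambda>_. borel) (\<lambda>i \<omega>. exp (l * (X i \<omega> - p i))) I"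
    by (intro indep_vars_compose2[OF indep]) auto
  have int: "integrable M (\<lambda>\<omega>. exp (l * (X i \<omega> - p i)))" if "i \<in> I" for i
    using expectation_fun_X(1)[OF that, of "\<lambda>x. exp (l * (x - p i))"] .
  show "integrable M (\<lambda>\<omega>. exp (l * ((\<Sum>i\<in>I. X i \<omega>) - (\<Sum>i\<in>I. p i))))"
    unfolding eq by (intro indep_vars_integrable fin ind int)
  show "expectation (\<lambda>\<omega>. exp (l * ((\<Sum>i\<in>I. X i \<omega>) - (\<Sum>i\<in>I. p i))))
      = (\<Prod>i\<in>I. p i * exp (l * (1 - p i)) + (1 - p i) * exp (- l * p i))"
    unfolding eq indep_vars_lebesgue_integral[OF fin ind int, simplified]
    by (intro prod.cong refl) (simp add: expectation_fun_X(2)[where f = "\<lambda>x. exp (l * (x - p _))"])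
qed

lemma mgf_le:
  assumes l: "\<bar>l\<bar> \<le> 1"
  shows "expectation (\<lambda>\<omega>. exp (l * ((\<Sum>i\<in>I. X i \<omega>) - (\<Sum>i\<in>I. p i))))
    \<le> exp (l\<^sup>2 / 2 * (1 + \<bar>l\<bar>) * (\<Sum>i\<in>I. p i * (1 - p i)))"
  unfolding mgf_eq sum_distrib_left exp_sum[OF fin]
proof (intro prod_mono conjI)
  fix i assume "i \<in> I"
  note p = p_bounds(1)[OF this] p_bounds(2)[OF this]
  then show "0 \<le> p i * exp (l * (1 - p i)) + (1 - p i) * exp (- l * p i)"
    by (intro add_nonneg_nonneg mult_nonneg_nonneg) auto
  show "p i * exp (l * (1 - p i)) + (1 - p i) * exp (- l * p i)
    \<le> exp (l\<^sup>2 / 2 * (1 + \<bar>l\<bar>) * (p i * (1 - p i)))"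
    using p l by (rule centered_bernoulli_mgf_le)
qed

lemma mgf_ge:
  assumes l: "0 \<le> l" "l \<le> 1"
  shows "exp (l\<^sup>2 / 2 * (1 - 2 * l) * (\<Sum>i\<in>I. p i * (1 - p i)))
    \<le> expectation (\<lambda>\<omega>. exp (l * ((\<Sum>i\<in>I. X i \<omega>) - (\<Sum>i\<in>I. p i))))"
  unfolding mgf_eq sum_distrib_left exp_sum[OF fin]
  by (intro prod_mono conjI centered_bernoulli_mgf_ge p_bounds l exp_ge_zero)

text \<open>Markov's inequality for the exponential. Allowing \<open>l\<close> of either sign lets
  the upper and lower tails share one proof.\<close>

lemma chernoff:
  assumes l: "\<bar>l\<bar> \<le> 1"
  shows "prob {\<omega> \<in> space M. l * ((\<Sum>i\<in>I. X i \<omega>) - (\<Sum>i\<in>I. p i)) \<ge> t}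
    \<le> exp (- t + l\<^sup>2 / 2 * (1 + \<bar>l\<bar>) * (\<Sum>i\<in>I. p i * (1 - p i)))"
proof -
  define Z where "Z \<omega> = exp (l * ((\<Sum>i\<in>I. X i \<omega>) - (\<Sum>i\<in>I. p i)))" for \<omega>
  have int: "integrable M Z"
    using mgf_eq(1)[of l] unfolding Z_def .
  have "prob {\<omega> \<in> space M. l * ((\<Sum>i\<in>I. X i \<omega>) - (\<Sum>i\<in>I. p i)) \<ge> t} = prob {\<omega> \<in> space M. Z \<omega> \<ge> exp t}"
    by (simp add: Z_def)
  also have "\<dots> \<le> expectation Z / exp t"
  proof (rule integral_Markov_inequality_measure[where A = "{}"])
    show "AE \<omega> in M. 0 \<le> Z \<omega>" by (simp add: Z_def)
  qed (use int in auto)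
  also have "\<dots> \<le> exp (l\<^sup>2 / 2 * (1 + \<bar>l\<bar>) * (\<Sum>i\<in>I. p i * (1 - p i))) / exp t"
    unfolding Z_def by (intro divide_right_mono mgf_le l exp_ge_zero)
  also have "\<dots> = exp (l\<^sup>2 / 2 * (1 + \<bar>l\<bar>) * (\<Sum>i\<in>I. p i * (1 - p i)) - t)"
    by (rule exp_diff[symmetric])
  finally show ?thesis by simp
qed

lemma chernoff_ge:
  assumes l: "0 < l" "l \<le> 1"
  shows "prob {\<omega> \<in> space M. (\<Sum>i\<in>I. X i \<omega>) \<ge> (\<Sum>i\<in>I. p i) + t}
    \<le> exp (- l * t + l\<^sup>2 / 2 * (1 + l) * (\<Sum>i\<in>I. p i * (1 - p i)))"
proof -
  have "(x \<ge> y + t) \<longleftrightarrow> (l * (x - y) \<ge> l * t)" for x y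
    using l by (subst mult_le_cancel_left_pos) auto
  then show ?thesis
    using chernoff[of l "l * t"] l by simp
qed

lemma chernoff_le:
  assumes l: "0 < l" "l \<le> 1"
  shows "prob {\<omega> \<in> space M. (\<Sum>i\<in>I. X i \<omega>) \<le> (\<Sum>i\<in>I. p i) - t}
    \<le> exp (- l * t + l\<^sup>2 / 2 * (1 + l) * (\<Sum>i\<in>I. p i * (1 - p i)))"
proof -
  have "(x \<le> y - t) \<longleftrightarrow> ((- l) * (x - y) \<ge> l * t)" for x y
  proof -
    have "(l * t \<le> (- l) * (x - y)) \<longleftrightarrow> (l * t \<le> l * (y - x))"
      by (simp add: algebra_simps)
    also have "\<dots> \<longleftrightarrow> t \<le> y - x"
      using l(1) by (rule mult_le_cancel_left_pos)
    finally show ?thesis by auto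
  qed
  then show ?thesis
    using chernoff[of "- l" "l * t"] l by simp
qed

sublocale hoeffding: Hoeffding_ineq M I X "\<lambda>_. 0" "\<lambda>_. 1" "\<Sum>i\<in>I. p i"
proof unfold_locales
  show "(\<Sum>i\<in>I. p i) \<equiv> (\<Sum>i\<in>I. expectation (X i))"
    by (intro eq_reflection sum.cong) (auto simp: expectation_fun_X(2)[where f = "\<lambda>x. x"])
  show "AE \<omega> in M. X i \<omega> \<in> {0..1}" if "i \<in> I" for i
    using X01[OF that] by (intro AE_I2) fastforce
qed (auto simp: fin indep)

text \<open>Any \<open>n\<close> above the number of summands will do, so callers with
  \<open>N - 1\<close> games can use \<open>N\<close>. An empty \<open>I\<close> would put a zero in
  the intermediate denominator; there the event is empty if \<open>t > 0\<close>, and the bound is 1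
  if \<open>t = 0\<close>.\<close>

lemma hoeffding_ge:
  assumes "t \<ge> 0" "card I \<le> n"
  shows "prob {\<omega> \<in> space M. (\<Sum>i\<in>I. X i \<omega>) \<ge> (\<Sum>i\<in>I. p i) + t} \<le> exp (- 2 * t\<^sup>2 / n)"
proof (cases "I = {} \<or> t = 0")
  case True
  then show ?thesis
  proof (cases "t = 0")
    case False
    then have e: "{\<omega> \<in> space M. (\<Sum>i\<in>I. X i \<omega>) \<ge> (\<Sum>i\<in>I. p i) + t} = {}"
      using assms True by auto
    show ?thesis unfolding e by simp
  qed simp
next
  case False
  then have c: "card I > 0" using fin by (simp add: card_gt_0_iff)
  then have "prob {\<omega> \<in> space M. (\<Sum>i\<in>I. X i \<omega>) \<ge> (\<Sum>i\<in>I. p i) + t} \<le> exp (- 2 * t\<^sup>2 / card I)"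
    using hoeffding.Hoeffding_ineq_ge[OF assms(1)] by simp
  also have "2 * t\<^sup>2 / n \<le> 2 * t\<^sup>2 / card I"
    using c assms(2) by (intro divide_left_mono mult_pos_pos) auto
  then have "exp (- 2 * t\<^sup>2 / card I) \<le> exp (- 2 * t\<^sup>2 / n)"
    by simp
  finally show ?thesis .
qed

lemma hoeffding_le:
  assumes "t \<ge> 0" "card I \<le> n"
  shows "prob {\<omega> \<in> space M. (\<Sum>i\<in>I. X i \<omega>) \<le> (\<Sum>i\<in>I. p i) - t} \<le> exp (- 2 * t\<^sup>2 / n)"
proof (cases "I = {} \<or> t = 0")
  case True
  then show ?thesis
  proof (cases "t = 0")
    case False
    then have e: "{\<omega> \<in> space M. (\<Sum>i\<in>I. X i \<omega>) \<le> (\<Sum>i\<in>I. p i) - t} = {}"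
      using assms True by auto
    show ?thesis unfolding e by simp
  qed simp
next
  case False
  then have c: "card I > 0" using fin by (simp add: card_gt_0_iff)
  then have "prob {\<omega> \<in> space M. (\<Sum>i\<in>I. X i \<omega>) \<le> (\<Sum>i\<in>I. p i) - t} \<le> exp (- 2 * t\<^sup>2 / card I)"
    using hoeffding.Hoeffding_ineq_le[OF assms(1)] by simp
  also have "2 * t\<^sup>2 / n \<le> 2 * t\<^sup>2 / card I"
    using c assms(2) by (intro divide_left_mono mult_pos_pos) auto
  then have "exp (- 2 * t\<^sup>2 / card I) \<le> exp (- 2 * t\<^sup>2 / n)"
    by simp
  finally show ?thesis .
qed

end

text \<open>
  A Cramer-type lower bound without change of measure: at \<open>l = (1 + r) * a\<close> the contributions of
  \<open>Y < a * s\<close> and \<open>Y > (1 + 2 * r) * (a * s)\<close> to the moment generating function are controlled by its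
  values at \<open>a\<close> and \<open>(1 + 2 * r) * a\<close> and are negligible, so the event in between carries half of it.
\<close>

lemma (in prob_space) tail_ge_of_mgf:
  fixes Y :: "'a \<Rightarrow> real" and a s r h :: real
  assumes a: "a > 0" and s: "s > 0" and r: "0 < r" "r \<le> 1" and h: "0 \<le> h" "32 * h \<le> r\<^sup>2"
    and large: "8 \<le> a\<^sup>2 * s * r\<^sup>2"
    and int: "\<And>l. integrable M (\<lambda>\<omega>. exp (l * Y \<omega>))"
    and [measurable]: "Y \<in> borel_measurable M"
    and up: "\<And>l. 0 \<le> l \<Longrightarrow> l \<le> 3 * a \<Longrightarrow> expectation (\<lambda>\<omega>. exp (l * Y \<omega>)) \<le> exp (l\<^sup>2 / 2 * (1 + h) * s)"
    and low: "\<And>l. 0 \<le> l \<Longrightarrow> l \<le> 3 * a \<Longrightarrow> exp (l\<^sup>2 / 2 * (1 - h) * s) \<le> expectation (\<lambda>\<omega>. exp (l * Y \<omega>))"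
  shows "prob {\<omega> \<in> space M. Y \<omega> \<ge> a * s} \<ge> exp (- (a\<^sup>2 * s / 2) * (1 + 2 * r)\<^sup>2) / 2"
proof -
  define L where "L = a\<^sup>2 * s"
  have L: "L > 0" using a s by (simp add: L_def)
  define x z where "x = a * s" and "z = (1 + 2 * r) * (a * s)"
  define l where "l = (1 + r) * a"
  define A where "A = {\<omega> \<in> space M. Y \<omega> \<ge> x}"
  have [measurable]: "A \<in> sets M" unfolding A_def by measurable
  have l: "0 \<le> l" "l \<le> 3 * a" "a \<le> l" "l \<le> (1 + 2 * r) * a" "(1 + 2 * r) * a \<le> 3 * a" "0 \<le> (1 + 2 * r) * a"
    using a r by (auto simp: l_def intro!: mult_right_mono)
  \<comment> \<open>Below \<open>x\<close> the exponential is dominated by tilting down to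
    \<open>a\<close>, above \<open>z\<close> by tilting up to \<open>(1 + 2 * r) * a\<close>; on the
    window in between it is at most \<open>exp (l * z)\<close>.\<close>
  have pw: "exp (l * Y \<omega>) \<le> exp ((l - a) * x) * exp (a * Y \<omega>)
      + exp (- ((1 + 2 * r) * a - l) * z) * exp ((1 + 2 * r) * a * Y \<omega>) + exp (l * z) * indicator A \<omega>"
    if "\<omega> \<in> space M" for \<omega>
  proof -
    consider "Y \<omega> < x" | "Y \<omega> > z" | "x \<le> Y \<omega>" "Y \<omega> \<le> z" by linarith
    then show ?thesis
    proof cases
      case 1
      have "l * Y \<omega> \<le> (l - a) * x + a * Y \<omega>"
        using mult_left_mono[of "Y \<omega>" x "l - a"] 1 l by (simp add: algebra_simps)
      then have "exp (l * Y \<omega>) \<le> exp ((l - a) * x) * exp (a * Y \<omega>)"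
        by (simp flip: exp_add)
      then show ?thesis by (simp add: add_increasing2)
    next
      case 2
      have "l * Y \<omega> \<le> - ((1 + 2 * r) * a - l) * z + (1 + 2 * r) * a * Y \<omega>"
        using mult_left_mono[of z "Y \<omega>" "(1 + 2 * r) * a - l"] 2 l by (simp add: algebra_simps)
      then have "exp (l * Y \<omega>) \<le> exp (- ((1 + 2 * r) * a - l) * z) * exp ((1 + 2 * r) * a * Y \<omega>)"
        by (simp flip: exp_add)
      then show ?thesis by (simp add: add_increasing2 add_increasing)
    next
      case 3
      then have "exp (l * Y \<omega>) \<le> exp (l * z) * indicator A \<omega>"
        using that l by (simp add: A_def mult_left_mono)
      then show ?thesis by (simp add: add_increasing)
    qed
  qed
  let ?E = "\<lambda>l. expectation (\<lambda>\<omega>. exp (l * Y \<omega>))"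
  have iA: "integrable M (\<lambda>\<omega>. exp (l * z) * indicator A \<omega>)"
    by (simp add: emeasure_eq_measure)
  have "?E l \<le> expectation (\<lambda>\<omega>. exp ((l - a) * x) * exp (a * Y \<omega>)
      + exp (- ((1 + 2 * r) * a - l) * z) * exp ((1 + 2 * r) * a * Y \<omega>) + exp (l * z) * indicator A \<omega>)"
    by (intro integral_mono Bochner_Integration.integrable_add integrable_mult_right int iA pw)
  also have "\<dots> = exp ((l - a) * x) * ?E a + exp (- ((1 + 2 * r) * a - l) * z) * ?E ((1 + 2 * r) * a)
      + exp (l * z) * prob A"
    using int iA by (simp add: emeasure_eq_measure)
  finally have main: "?E l \<le> exp ((l - a) * x) * ?E a + exp (- ((1 + 2 * r) * a - l) * z) * ?E ((1 + 2 * r) * a)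
      + exp (l * z) * prob A" .
  define B where "B = l\<^sup>2 / 2 * (1 - h) * s"
  have h1: "(1 + r)\<^sup>2 * h \<le> 4 * h"
    using power_mono[of "1 + r" 2 2] r h by (intro mult_right_mono) auto
  have h2: "(1 + 2 * r)\<^sup>2 * h \<le> 9 * h"
    using power_mono[of "1 + 2 * r" 3 2] r h by (intro mult_right_mono) auto
  have B: "B = L * ((1 + r)\<^sup>2 / 2 * (1 - h))"
    by (simp add: B_def l_def L_def power_mult_distrib)
  \<comment> \<open>Without \<open>h\<close>, both outer exponents are
    \<open>L * (1 / 2 + r)\<close>, which is \<open>L * r^2 / 2\<close> below
    \<open>L * (1 + r)^2 / 2\<close>. The errors in \<open>h\<close> use up at most half of this
    gap, and the other half, \<open>L * r^2 / 4\<close>, is at least 2 by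
    \<open>large\<close>.\<close>
  have cmp: "L * c + 2 \<le> B" if "c \<le> (1 + r)\<^sup>2 / 2 * (1 - h) - r\<^sup>2 / 4" for c
  proof -
    have "L * c \<le> L * ((1 + r)\<^sup>2 / 2 * (1 - h) - r\<^sup>2 / 4)"
      using that L by (intro mult_left_mono) auto
    then show ?thesis
      using large by (simp add: B right_diff_distrib flip: L_def)
  qed
  have B1: "exp ((l - a) * x) * ?E a \<le> exp (B - 2)"
  proof -
    have "exp ((l - a) * x) * ?E a \<le> exp ((l - a) * x) * exp (a\<^sup>2 / 2 * (1 + h) * s)"
      using a by (intro mult_left_mono up) auto
    also have "\<dots> = exp (L * (r + (1 + h) / 2))"
      by (simp add: l_def x_def L_def algebra_simps power2_eq_square flip: exp_add)
    also have "\<dots> \<le> exp (B - 2)"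
      using cmp[of "r + (1 + h) / 2"] h1 h by (simp add: power2_eq_square field_simps)
    finally show ?thesis .
  qed
  have B2: "exp (- ((1 + 2 * r) * a - l) * z) * ?E ((1 + 2 * r) * a) \<le> exp (B - 2)"
  proof -
    have "exp (- ((1 + 2 * r) * a - l) * z) * ?E ((1 + 2 * r) * a)
        \<le> exp (- ((1 + 2 * r) * a - l) * z) * exp (((1 + 2 * r) * a)\<^sup>2 / 2 * (1 + h) * s)"
      using l by (intro mult_left_mono up) auto
    also have "\<dots> = exp (- ((1 + 2 * r) * a - l) * z + ((1 + 2 * r) * a)\<^sup>2 / 2 * (1 + h) * s)"
      by (simp only: exp_add)
    also have "- ((1 + 2 * r) * a - l) * z + ((1 + 2 * r) * a)\<^sup>2 / 2 * (1 + h) * s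
        = L * ((1 + 2 * r)\<^sup>2 / 2 * (1 + h) - r * (1 + 2 * r))"
      by (simp add: l_def z_def L_def field_simps power2_eq_square)
    also have "exp \<dots> \<le> exp (B - 2)"
      using cmp[of "(1 + 2 * r)\<^sup>2 / 2 * (1 + h) - r * (1 + 2 * r)"] h1 h2 h
      by (simp add: power2_eq_square field_simps)
    finally show ?thesis .
  qed
  \<comment> \<open>Each outer piece is then at most a quarter of \<open>exp B\<close>, so the
    window carries at least half.\<close>
  have "exp (2::real) \<ge> 4"
    using exp_lower_Taylor_quadratic[of 2] by simp
  then have "exp (B - 2) \<le> exp B / 4"
    by (simp add: exp_diff field_simps)
  moreover have "exp B \<le> ?E l"
    unfolding B_def using l by (intro low) auto
  ultimately have "exp B / 2 \<le> exp (l * z) * prob A"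
    using main B1 B2 by linarith
  then have "exp (B - l * z) / 2 \<le> prob A"
    by (simp add: exp_diff field_simps)
  moreover have "- (L / 2) * (1 + 2 * r)\<^sup>2 \<le> B - l * z"
  proof -
    have "l * z = L * ((1 + r) * (1 + 2 * r))"
      by (simp add: l_def z_def L_def power2_eq_square)
    moreover have "- (L / 2) * (1 + 2 * r)\<^sup>2 = L * (1 / 2 + r) - L * ((1 + r) * (1 + 2 * r))"
      by (simp add: power2_eq_square field_simps)
    moreover have "L * (1 / 2 + r) + 2 \<le> B"
      using h1 h by (intro cmp) (simp add: power2_eq_square field_simps)
    ultimately show ?thesis by linarith
  qed
  then have "exp (- (L / 2) * (1 + 2 * r)\<^sup>2) \<le> exp (B - l * z)"
    by (rule exp_le_cancel_iff[THEN iffD2])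
  ultimately have "exp (- (L / 2) * (1 + 2 * r)\<^sup>2) / 2 \<le> prob A"
    by linarith
  then show ?thesis
    unfolding A_def x_def L_def .
qed

subsection \<open>The quenched tournament\<close>

lemma finite_pairs [simp]: "finite (pairs N)"
  by (rule finite_subset[of _ "{1..N+1} \<times> {1..N+1}"]) (auto simp: pairs_def)

text \<open>Each \<open>f i\<close> factors through the restriction to its own block
  \<open>K i\<close> of games, and disjoint blocks of independent coordinates are independent.
  Measurability is automatic because a finite product of discrete spaces is discrete.\<close>

lemma tournament_indep:
  fixes f :: "'i \<Rightarrow> (nat \<times> nat \<Rightarrow> bool) \<Rightarrow> real"
  assumes K: "\<And>i. i \<in> L \<Longrightarrow> K i \<subseteq> pairs N" and disj: "disjoint_family_on K L"
    and dep: "\<And>i x y. i \<in> L \<Longrightarrow> (\<And>e. e \<in> K i \<Longrightarrow> x e = y e) \<Longrightarrow> f i x = f i y"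
  shows "prob_space.indep_vars (measure_pmf (tournament N V)) (\<lambda>_. borel) f L"
proof -
  let ?T = "measure_pmf (tournament N V)"
  have ind: "prob_space.indep_vars ?T (\<lambda>_. count_space UNIV) (\<lambda>e x. x e) (pairs N)"
    unfolding tournament_def by (rule indep_vars_Pi_pmf[OF finite_pairs])
  have meas: "f i \<in> borel_measurable (PiM (K i) (\<lambda>_. count_space UNIV))" if "i \<in> L" for i
  proof -
    have "finite (K i)" using finite_subset[OF K[OF that] finite_pairs] .
    then have "PiM (K i) (\<lambda>_. count_space (UNIV :: bool set)) = count_space (PiE (K i) (\<lambda>_. UNIV))"
      by (intro count_space_PiM_finite) auto
    then show ?thesis by simp
  qed
  have "prob_space.indep_vars ?T (\<lambda>_. borel) (\<lambda>i x. f i (restrict (\<lambda>e. x e) (K i))) L"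
    using prob_space.indep_vars_compose2[OF measure_pmf.prob_space_axioms
      prob_space.indep_vars_restrict[OF measure_pmf.prob_space_axioms ind K disj] meas] .
  moreover have "prob_space.indep_vars ?T (\<lambda>_. borel) (\<lambda>i x. f i (restrict (\<lambda>e. x e) (K i))) L
      = prob_space.indep_vars ?T (\<lambda>_. borel) f L"
  proof (rule prob_space.indep_vars_cong[OF measure_pmf.prob_space_axioms refl _ refl])
    fix i assume "i \<in> L"
    show "(\<lambda>x. f i (restrict (\<lambda>e. x e) (K i))) = f i"
      by (rule ext, rule dep[OF \<open>i \<in> L\<close>]) simp
  qed
  ultimately show ?thesis by simp
qed

lemma prob_Xres:
  assumes "i \<in> {1..N+1}" "j \<in> {1..N+1}" "i \<noteq> j" and V: "V i > 0" "V j > 0"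
  shows "measure_pmf.prob (tournament N V) {x. real (Xres x i j) = 1} = V i / (V i + V j)"
proof -
  have comp: "measure_pmf.prob (tournament N V) {x. P (x e)}
      = measure_pmf.prob (bernoulli_pmf (V (fst e) / (V (fst e) + V (snd e)))) {b. P b}" if "e \<in> pairs N" for P e
  proof -
    have "map_pmf (\<lambda>x. x e) (tournament N V) = bernoulli_pmf (V (fst e) / (V (fst e) + V (snd e)))"
      unfolding tournament_def using that by (subst Pi_pmf_component) (auto simp: case_prod_unfold)
    then show ?thesis
      using measure_map_pmf[of "\<lambda>x. x e" "tournament N V" "{b. P b}"] by (simp add: vimage_def)
  qed
  have q: "0 \<le> V a / (V a + V b)" "V a / (V a + V b) \<le> 1" if "V a > 0" "V b > 0" for a b
    using that by auto
  show ?thesis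
  proof (cases "i < j")
    case True
    then have "{x. real (Xres x i j) = 1} = {x. x (i, j)}"
      by (auto simp: Xres_def)
    moreover have "(i, j) \<in> pairs N"
      using True assms by (auto simp: pairs_def)
    moreover have "{b. b} = {True}" by auto
    ultimately show ?thesis
      using comp[of "(i, j)" "\<lambda>b. b"] q[OF V] by (simp add: measure_pmf_single)
  next
    case False
    then have "{x. real (Xres x i j) = 1} = {x. \<not> x (j, i)}"
      using assms by (auto simp: Xres_def)
    moreover have "(j, i) \<in> pairs N"
      using False assms by (auto simp: pairs_def)
    moreover have "{b. \<not> b} = {False}" by auto
    moreover have "1 - V j / (V j + V i) = V i / (V i + V j)"
      using V by (simp add: field_simps)
    ultimately show ?thesis
      using comp[of "(j, i)" "\<lambda>b. \<not> b"] q[OF V(2,1)] by (simp add: measure_pmf_single)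
  qed
qed

text \<open>The coordinate that stores the result between two players, whichever index is smaller;
  this allows independence arguments without distinguishing the order of the opponents.\<close>

definition game :: "nat \<Rightarrow> nat \<Rightarrow> nat \<times> nat" where
  "game i j = (min i j, max i j)"

lemma game_in_pairs: "i \<in> {1..N+1} \<Longrightarrow> j \<in> {1..N+1} \<Longrightarrow> i \<noteq> j \<Longrightarrow> game i j \<in> pairs N"
  by (auto simp: game_def pairs_def min_def max_def)

lemma game_eq_iff: "game i j = game i' j' \<longleftrightarrow> (i = i' \<and> j = j') \<or> (i = j' \<and> j = i')"
  by (auto simp: game_def min_def max_def)

lemma Xres_cong: "x (game i j) = y (game i j) \<Longrightarrow> Xres x i j = Xres y i j"
  by (auto simp: game_def Xres_def min_def max_def split: if_splits)

lemma Xres_01: "Xres x i j = 0 \<or> Xres x i j = 1"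
  by (auto simp: Xres_def)

text \<open>For a fixed player, distinct opponents correspond to distinct coordinates, so that
  player's games are independent.\<close>

lemma indep_bernoulli_Xres:
  assumes i: "i \<in> {1..N+1}" and B: "B \<subseteq> {1..N+1} - {i}" and V: "\<And>k. k \<in> {1..N+1} \<Longrightarrow> V k > 0"
  shows "indep_bernoulli (measure_pmf (tournament N V)) B (\<lambda>j x. real (Xres x i j)) (\<lambda>j. V i / (V i + V j))"
proof -
  let ?T = "measure_pmf (tournament N V)"
  show ?thesis
  proof unfold_locales
    show "finite B" using B by (rule finite_subset) simp
    show "prob_space.indep_vars ?T (\<lambda>_. borel) (\<lambda>j x. real (Xres x i j)) B"
    proof (rule tournament_indep[where K = "\<lambda>j. {game i j}"])
      show "{game i j} \<subseteq> pairs N" if "j \<in> B" for j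
        using game_in_pairs[of i N j] i subsetD[OF B that] by auto
      show "disjoint_family_on (\<lambda>j. {game i j}) B"
        by (auto simp: disjoint_family_on_def game_eq_iff)
      show "real (Xres x i j) = real (Xres y i j)" if "\<And>e. e \<in> {game i j} \<Longrightarrow> x e = y e" for j x y
        using Xres_cong[of x i j y] that by simp
    qed
    show "measure ?T {x \<in> space ?T. real (Xres x i j) = 1} = V i / (V i + V j)" if "j \<in> B" for j
      using prob_Xres[of i N j V] i subsetD[OF B that] V by auto
    show "real (Xres x i j) = 0 \<or> real (Xres x i j) = 1" for j x
      using Xres_01[of x i j] by auto
  qed
qed

text \<open>Sorting only permutes the sample. Symmetric sums over the order statistics, such as the
  drift or the number of players near 1, therefore reduce to sums over the i.i.d. sample.\<close>

lemma sum_strengths: "(\<Sum>k=1..N. f (strengths N w u k)) = (\<Sum>k=1..N. f (w k) :: real)"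
proof -
  define xs where "xs = map w [1..<N+1]"
  have len: "length (sort xs) = N" by (simp add: xs_def)
  have "(\<Sum>k=1..N. f (strengths N w u k)) = (\<Sum>k=1..N. f (sort xs ! (k - 1)))"
    by (intro sum.cong) (auto simp: strengths_def order_stat_def xs_def)
  also have "\<dots> = (\<Sum>k<N. f (sort xs ! k))"
    by (rule sum.reindex_bij_witness[of _ Suc "\<lambda>k. k - 1"]) auto
  also have "\<dots> = sum_list (map f (sort xs))"
    using len by (simp add: sum_list_sum_nth atLeast0LessThan)
  also have "\<dots> = sum_mset (image_mset f (mset (sort xs)))"
    by (metis mset_map sum_mset_sum_list)
  also have "\<dots> = sum_list (map f xs)"
    by (metis mset_map mset_sort sum_mset_sum_list)
  also have "\<dots> = (\<Sum>k\<in>{1..<N+1}. f (w k))"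
    by (simp add: xs_def o_def interv_sum_list_conv_sum_set_nat del: upt_Suc)
  also have "{1..<N+1} = {1..N}" by auto
  finally show ?thesis .
qed

lemma strengths_mem:
  assumes "k \<in> {1..N}"
  shows "strengths N w u k \<in> w ` {1..N}"
proof -
  have "sort (map w [1..<N+1]) ! (k - 1) \<in> set (sort (map w [1..<N+1]))"
    using assms by (intro nth_mem) (auto simp: length_sort)
  also have "\<dots> = w ` {1..N}"
    by (auto simp del: upt_Suc)
  finally show ?thesis
    using assms by (simp add: strengths_def order_stat_def)
qed

subsection \<open>The random environment\<close>

text \<open>Every point outside the support has a null ball around it. By the Lindelof property
  countably many open null sets cover everything above \<open>c\<close>.\<close>

lemma AE_le_of_dist_support:
  assumes "prob_space D" and sets_D: "sets D = sets borel" and le: "\<forall>x\<in>dist_support D. x \<le> c"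
  shows "AE x in D. x \<le> c"
proof -
  interpret prob_space D by fact
  define F where "F = {B :: real set. open B \<and> prob B = 0}"
  obtain F' where F': "F' \<subseteq> F" "countable F'" "\<Union>F' = \<Union>F"
    using Lindelof[of F] by (auto simp: F_def)
  have "\<Union>F' \<in> null_sets D"
  proof (rule null_sets_UN'[of F' "\<lambda>B. B" D, simplified, OF F'(2)])
    fix B assume "B \<in> F'"
    then have "open B" "prob B = 0" using F' by (auto simp: F_def)
    then show "B \<in> null_sets D"
      using sets_D by (auto simp: null_sets_def emeasure_eq_measure)
  qed
  then have "AE x in D. x \<notin> \<Union>F'" by (rule AE_not_in)
  then show ?thesis
  proof (rule AE_mp, intro AE_I2 impI)
    fix x assume "x \<notin> \<Union>F'"
    show "x \<le> c"
    proof (rule ccontr)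
      assume "\<not> x \<le> c"
      then have "x \<notin> dist_support D" using le by auto
      then obtain e where "e > 0" "\<not> prob (ball x e) > 0" by (auto simp: dist_support_def)
      then have "ball x e \<in> F" "x \<in> ball x e"
        by (auto simp: F_def zero_less_measure_iff)
      then show False using F'(3) \<open>x \<notin> \<Union>F'\<close> by blast
    qed
  qed
qed

lemma (in prob_space) borel_cantelli_eventually:
  assumes "\<And>n. A n \<in> events" "\<forall>\<^sub>F n in sequentially. prob (A n) \<le> b n" "summable b"
  shows "AE \<omega> in M. \<forall>\<^sub>F n in sequentially. \<omega> \<notin> A n"
proof -
  have "summable (\<lambda>n. prob (A n))"
    by (rule summable_comparison_test_ev[OF _ assms(3)]) (use assms(2) in simp)
  then have "AE \<omega> in M. \<forall>\<^sub>F n in sequentially. \<omega> \<in> space M - A n"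
    by (intro borel_cantelli_AE1) (use assms in \<open>auto simp: emeasure_eq_measure\<close>)
  then show ?thesis
    by (rule AE_mp) (auto intro!: AE_I2 elim: eventually_mono)
qed

text \<open>For bounded variables Hoeffding's inequality gives summable deviation probabilities at
  every fixed level, so Borel-Cantelli suffices.\<close>

lemma (in prob_space) strong_law_bounded:
  fixes X :: "nat \<Rightarrow> 'a \<Rightarrow> real"
  assumes indep: "indep_vars (\<lambda>_. borel) X {1..}"
    and distr: "\<And>k. k \<ge> 1 \<Longrightarrow> distr M borel (X k) = distr M borel Y"
    and Y [measurable]: "Y \<in> borel_measurable M" and Y01: "AE \<omega> in M. Y \<omega> \<in> {0..1}"
  shows "AE \<omega> in M. (\<lambda>N. (\<Sum>k=1..N. X k \<omega>) / real N) \<longlonglongrightarrow> expectation Y"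
proof -
  have X [measurable]: "X k \<in> borel_measurable M" if "k \<ge> 1" for k
    using indep that by (auto simp: indep_vars_def)
  have *: "AE \<omega> in M. \<forall>\<^sub>F N in sequentially. \<bar>(\<Sum>k=1..N. X k \<omega>) / real N - expectation Y\<bar> < e" if "e > 0" for e
  proof -
    define A where "A N = {\<omega> \<in> space M. \<bar>(\<Sum>k=1..N. X k \<omega>) / real N - expectation Y\<bar> \<ge> e}" for N
    have "(\<lambda>\<omega>. \<Sum>k=1..N. X k \<omega>) \<in> borel_measurable M" for N
      by (rule borel_measurable_sum) (use X in auto)
    then have meas: "A N \<in> events" for N
      unfolding A_def by measurable
    have "prob (A N) \<le> 2 * exp (- 2 * real N * e\<^sup>2)" if N: "N \<ge> 1" for N
    proof -
      interpret H: Hoeffding_ineq_iid M "{1..N}" X Y 0 1 "expectation Y"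
        by unfold_locales (use indep_vars_subset[OF indep] distr Y01 in auto)
      show ?thesis
        using H.Hoeffding_ineq_abs_ge'[of e] \<open>e > 0\<close> N by (simp add: A_def)
    qed
    then have "\<forall>\<^sub>F N in sequentially. prob (A N) \<le> 2 * exp (- 2 * real N * e\<^sup>2)"
      unfolding eventually_sequentially by blast
    moreover have "summable (\<lambda>N. 2 * exp (- 2 * real N * e\<^sup>2))"
    proof -
      have "(\<lambda>N. 2 * exp (- 2 * real N * e\<^sup>2)) = (\<lambda>N. 2 * exp (- 2 * e\<^sup>2) ^ N)"
        by (auto simp: exp_of_nat_mult[symmetric] mult_ac)
      moreover have "summable (\<lambda>N. 2 * exp (- 2 * e\<^sup>2) ^ N)"
        using \<open>e > 0\<close> by (intro summable_mult summable_geometric) auto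
      ultimately show ?thesis by simp
    qed
    ultimately have "AE \<omega> in M. \<forall>\<^sub>F N in sequentially. \<omega> \<notin> A N"
      by (rule borel_cantelli_eventually[OF meas])
    then show ?thesis
      by (rule AE_mp) (auto intro!: AE_I2 elim!: eventually_mono simp: A_def)
  qed
  \<comment> \<open>Passing to the levels \<open>1 / (m + 1)\<close> keeps the number of exceptional
    null sets countable.\<close>
  have "AE \<omega> in M. \<forall>m::nat. \<forall>\<^sub>F N in sequentially. \<bar>(\<Sum>k=1..N. X k \<omega>) / real N - expectation Y\<bar> < 1 / real (Suc m)"
    unfolding AE_all_countable by (intro allI *) simp
  then show ?thesis
  proof (rule AE_mp, intro AE_I2 impI)
    fix \<omega> assume ev: "\<forall>m::nat. \<forall>\<^sub>F N in sequentially. \<bar>(\<Sum>k=1..N. X k \<omega>) / real N - expectation Y\<bar> < 1 / real (Suc m)"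
    show "(\<lambda>N. (\<Sum>k=1..N. X k \<omega>) / real N) \<longlonglongrightarrow> expectation Y"
    proof (rule tendstoI)
      fix e :: real assume "e > 0"
      then obtain m where "1 / real (Suc m) < e" using nat_approx_posE by blast
      then show "\<forall>\<^sub>F N in sequentially. dist ((\<Sum>k=1..N. X k \<omega>) / real N) (expectation Y) < e"
        using ev[rule_format, of m] by (auto simp: dist_real_def elim!: eventually_mono)
    qed
  qed
qed

section \<open>Number of sample points above a level that moves with \<open>N\<close>\<close>

context prob_space
begin

context
  fixes X :: "nat \<Rightarrow> 'a \<Rightarrow> real" and Y :: "'a \<Rightarrow> real" and c :: "nat \<Rightarrow> real" and q :: "nat \<Rightarrow> real"
  assumes indep: "indep_vars (\<lambda>_. borel) X {1..}"
    and distr: "\<And>k. k \<ge> 1 \<Longrightarrow> distr M borel (X k) = distr M borel Y"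
    and Y [measurable]: "Y \<in> borel_measurable M"
    and q_def: "\<And>N. q N = prob {\<omega> \<in> space M. Y \<omega> > c N}"
begin

lemma sample_measurable: "k \<ge> 1 \<Longrightarrow> X k \<in> borel_measurable M"
  using indep by (auto simp: indep_vars_def)

lemma count_measurable: "(\<lambda>\<omega>. \<Sum>k=1..N. of_bool (X k \<omega> > c N) :: real) \<in> borel_measurable M"
proof (rule borel_measurable_sum)
  fix k assume "k \<in> {1..N}"
  then have [measurable]: "X k \<in> borel_measurable M" by (simp add: sample_measurable)
  show "(\<lambda>\<omega>. of_bool (X k \<omega> > c N) :: real) \<in> borel_measurable M"
    by measurable
qed

lemma indep_bernoulli_count: "indep_bernoulli M {1..N} (\<lambda>k \<omega>. of_bool (X k \<omega> > c N)) (\<lambda>_. q N)"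
proof
  have "(\<lambda>x. of_bool (x > c N) :: real) \<in> borel_measurable borel" by measurable
  then show "indep_vars (\<lambda>_. borel) (\<lambda>k \<omega>. of_bool (X k \<omega> > c N) :: real) {1..N}"
    by (intro indep_vars_compose2[OF indep_vars_subset[OF indep]]) auto
  fix k assume "k \<in> {1..N}"
  then have k: "k \<ge> 1" by simp
  have "prob {\<omega> \<in> space M. X k \<omega> > c N} = measure (distr M borel (X k)) {c N<..}"
    using sample_measurable[OF k] by (subst measure_distr) (auto intro!: arg_cong[where f = prob])
  also have "\<dots> = q N"
    unfolding distr[OF k] q_def by (subst measure_distr) (auto intro!: arg_cong[where f = prob])
  finally show "prob {\<omega> \<in> space M. of_bool (X k \<omega> > c N) = (1::real)} = q N"
    by simp
qed auto

text \<open>Chernoff at \<open>l = 1/4\<close>: a level of at least twice the mean leaves a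
  deviation of at least \<open>y / 2\<close>, which outweighs the variance term. The bound involves
  \<open>y\<close> alone, so summability can later be checked without knowing \<open>q N\<close>
  exactly.\<close>

lemma prob_count_ge:
  assumes "2 * (real N * q N) \<le> y"
  shows "prob {\<omega> \<in> space M. (\<Sum>k=1..N. of_bool (X k \<omega> > c N)) \<ge> y} \<le> exp (- y / 16)"
proof -
  interpret indep_bernoulli M "{1..N}" "\<lambda>k \<omega>. of_bool (X k \<omega> > c N)" "\<lambda>_. q N"
    by (rule indep_bernoulli_count)
  have q0: "0 \<le> q N" "0 \<le> real N * q N" by (simp_all add: q_def)
  have "prob {\<omega> \<in> space M. (\<Sum>k=1..N. of_bool (X k \<omega> > c N)) \<ge> y}
      \<le> exp (- (1/4) * (y - real N * q N) + (1/4)\<^sup>2 / 2 * (1 + 1/4) * (real N * (q N * (1 - q N))))"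
    using chernoff_ge[of "1/4" "y - real N * q N"] by simp
  also have "\<dots> \<le> exp (- y / 16)"
  proof -
    have "real N * (q N * (1 - q N)) \<le> real N * q N"
      using q0 by (intro mult_left_mono) (auto simp: mult_left_le)
    moreover have "- (1/4) * (y - A) + (1/4)\<^sup>2 / 2 * (1 + 1/4) * B \<le> - y / 16"
      if "B \<le> A" "2 * A \<le> y" "0 \<le> A" "0 \<le> y" for A B :: real
      using that by (simp add: power2_eq_square field_simps)
    ultimately have "- (1/4) * (y - real N * q N) + (1/4)\<^sup>2 / 2 * (1 + 1/4) * (real N * (q N * (1 - q N))) \<le> - y / 16"
      using assms q0 by auto
    then show ?thesis by (rule exp_le_cancel_iff[THEN iffD2])
  qed
  finally show ?thesis .
qed

lemma prob_count_le:
  assumes "2 * y \<le> real N * q N" "0 \<le> y"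
  shows "prob {\<omega> \<in> space M. (\<Sum>k=1..N. of_bool (X k \<omega> > c N)) \<le> y} \<le> exp (- y / 16)"
proof -
  interpret indep_bernoulli M "{1..N}" "\<lambda>k \<omega>. of_bool (X k \<omega> > c N)" "\<lambda>_. q N"
    by (rule indep_bernoulli_count)
  have q0: "0 \<le> q N" "0 \<le> real N * q N" by (simp_all add: q_def)
  have "prob {\<omega> \<in> space M. (\<Sum>k=1..N. of_bool (X k \<omega> > c N)) \<le> y}
      \<le> exp (- (1/4) * (real N * q N - y) + (1/4)\<^sup>2 / 2 * (1 + 1/4) * (real N * (q N * (1 - q N))))"
    using chernoff_le[of "1/4" "real N * q N - y"] by simp
  also have "\<dots> \<le> exp (- y / 16)"
  proof -
    have "real N * (q N * (1 - q N)) \<le> real N * q N"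
      using q0 by (intro mult_left_mono) (auto simp: mult_left_le)
    moreover have "- (1/4) * (A - y) + (1/4)\<^sup>2 / 2 * (1 + 1/4) * B \<le> - y / 16"
      if "B \<le> A" "2 * y \<le> A" "0 \<le> A" "0 \<le> y" for A B :: real
      using that by (simp add: power2_eq_square field_simps)
    ultimately have "- (1/4) * (real N * q N - y) + (1/4)\<^sup>2 / 2 * (1 + 1/4) * (real N * (q N * (1 - q N))) \<le> - y / 16"
      using assms q0 by auto
    then show ?thesis by (rule exp_le_cancel_iff[THEN iffD2])
  qed
  finally show ?thesis .
qed

lemma AE_count_le:
  assumes "\<forall>\<^sub>F N in sequentially. 2 * (real N * q N) \<le> y N" "summable (\<lambda>N. exp (- y N / 16))"
  shows "AE \<omega> in M. \<forall>\<^sub>F N in sequentially. (\<Sum>k=1..N. of_bool (X k \<omega> > c N)) \<le> y N"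
proof -
  have "AE \<omega> in M. \<forall>\<^sub>F N in sequentially. \<omega> \<notin> {\<omega> \<in> space M. (\<Sum>k=1..N. of_bool (X k \<omega> > c N)) \<ge> y N}"
  proof (rule borel_cantelli_eventually[OF _ _ assms(2)])
    show "{\<omega> \<in> space M. (\<Sum>k=1..N. of_bool (X k \<omega> > c N)) \<ge> y N} \<in> events" for N
      using count_measurable[of N] by measurable
    show "\<forall>\<^sub>F N in sequentially. prob {\<omega> \<in> space M. (\<Sum>k=1..N. of_bool (X k \<omega> > c N)) \<ge> y N} \<le> exp (- y N / 16)"
      using assms(1) by eventually_elim (rule prob_count_ge)
  qed
  then show ?thesis
    by (rule AE_mp) (auto intro!: AE_I2 elim!: eventually_mono)
qed

lemma AE_count_ge:
  assumes "\<forall>\<^sub>F N in sequentially. 2 * y N \<le> real N * q N" "\<And>N. 0 \<le> y N" "summable (\<lambda>N. exp (- y N / 16))"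
  shows "AE \<omega> in M. \<forall>\<^sub>F N in sequentially. y N \<le> (\<Sum>k=1..N. of_bool (X k \<omega> > c N))"
proof -
  have "AE \<omega> in M. \<forall>\<^sub>F N in sequentially. \<omega> \<notin> {\<omega> \<in> space M. (\<Sum>k=1..N. of_bool (X k \<omega> > c N)) \<le> y N}"
  proof (rule borel_cantelli_eventually[OF _ _ assms(3)])
    show "{\<omega> \<in> space M. (\<Sum>k=1..N. of_bool (X k \<omega> > c N)) \<le> y N} \<in> events" for N
      using count_measurable[of N] by measurable
    show "\<forall>\<^sub>F N in sequentially. prob {\<omega> \<in> space M. (\<Sum>k=1..N. of_bool (X k \<omega> > c N)) \<le> y N} \<le> exp (- y N / 16)"
      using assms(1) by eventually_elim (rule prob_count_le[OF _ assms(2)])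
  qed
  then show ?thesis
    by (rule AE_mp) (auto intro!: AE_I2 elim!: eventually_mono)
qed

end

end

section \<open>Asymptotics on the scale of powers of \<open>N\<close>\<close>

lemma summable_exp_neg_powr:
  fixes c :: real
  assumes "c > 0"
  shows "summable (\<lambda>N. exp (- (real N powr c) / 16))"
proof (rule summable_comparison_test_bigo)
  show "summable (\<lambda>N. norm (1 / real N ^ 2))"
    using inverse_power_summable[of 2, where 'a = real] by (simp add: field_simps)
  show "(\<lambda>N. exp (- (real N powr c) / 16)) \<in> O(\<lambda>N. 1 / real N ^ 2)"
    using assms by real_asymp
qed

text \<open>At a scale \<open>u N\<close> of order \<open>N powr (- 1 / 2)\<close> up to
  subpolynomial factors, the hypothesis on the tail gives \<open>Q (1 - u N)\<close> the exponent
  \<open>- \<alpha> / 2\<close>. The proof multiplies and divides by \<open>ln (u N)\<close>, which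
  is eventually nonzero.\<close>

lemma tail_exponent:
  fixes u :: "nat \<Rightarrow> real" and Q :: "real \<Rightarrow> real"
  assumes Q: "(\<lambda>u. ln (Q (1 - u)) - \<alpha> * ln u) \<in> o[at_right 0](\<lambda>u. ln u)"
    and u: "filterlim u (at_right 0) sequentially" and lnu: "(\<lambda>N. ln (u N) / ln (real N)) \<longlonglongrightarrow> - 1 / 2"
  shows "(\<lambda>N. ln (Q (1 - u N)) / ln (real N)) \<longlonglongrightarrow> - \<alpha> / 2"
proof -
  have "((\<lambda>u. (ln (Q (1 - u)) - \<alpha> * ln u) / ln u) \<longlongrightarrow> 0) (at_right 0)"
    using smalloD_tendsto[OF Q] .
  from filterlim_compose[OF this u]
  have "(\<lambda>N. (ln (Q (1 - u N)) - \<alpha> * ln (u N)) / ln (u N)) \<longlonglongrightarrow> 0" .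
  from tendsto_add[OF tendsto_mult[OF this lnu] tendsto_mult[OF tendsto_const[of \<alpha>] lnu]]
  have lim: "(\<lambda>N. (ln (Q (1 - u N)) - \<alpha> * ln (u N)) / ln (u N) * (ln (u N) / ln (real N))
      + \<alpha> * (ln (u N) / ln (real N))) \<longlonglongrightarrow> - \<alpha> / 2"
    by simp
  have "\<forall>\<^sub>F N in sequentially. ln (u N) / ln (real N) < 0"
    using order_tendstoD(2)[OF lnu, of 0] by simp
  then have "\<forall>\<^sub>F N in sequentially. (ln (Q (1 - u N)) - \<alpha> * ln (u N)) / ln (u N) * (ln (u N) / ln (real N))
      + \<alpha> * (ln (u N) / ln (real N)) = ln (Q (1 - u N)) / ln (real N)"
  proof eventually_elim
    case (elim N)
    then have "ln (u N) \<noteq> 0" "ln (real N) \<noteq> 0" by auto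
    then show ?case by (simp add: field_simps)
  qed
  from tendsto_cong[OF this] lim show ?thesis by simp
qed

text \<open>The limit says that \<open>q N\<close> is \<open>N powr (b + o(1))\<close>. Half of
  \<kappa> absorbs the error in the exponent, the other half the factor 2 demanded by the counting
  bounds.\<close>

lemma eventually_powr_bounds:
  fixes q :: "nat \<Rightarrow> real"
  assumes lim: "(\<lambda>N. ln (q N) / ln (real N)) \<longlonglongrightarrow> b" and pos: "\<forall>\<^sub>F N in sequentially. q N > 0" and "\<kappa> > 0"
  shows "\<forall>\<^sub>F N in sequentially. 2 * (real N * q N) \<le> real N powr (1 + b + \<kappa>)"
    and "\<forall>\<^sub>F N in sequentially. 2 * real N powr (1 + b - \<kappa>) \<le> real N * q N"
proof -
  have N: "\<forall>\<^sub>F N in sequentially. real N powr (\<kappa> / 2) \<ge> 2 \<and> real N \<ge> 2"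
  proof (rule eventually_conj)
    have "filterlim (\<lambda>N. real N powr (\<kappa> / 2)) at_top sequentially"
      using \<open>\<kappa> > 0\<close> by real_asymp
    then show "\<forall>\<^sub>F N in sequentially. real N powr (\<kappa> / 2) \<ge> 2"
      by (auto simp: filterlim_at_top)
    show "\<forall>\<^sub>F N in sequentially. real N \<ge> 2"
      by real_asymp
  qed
  have e: "\<forall>\<^sub>F N in sequentially. ln (q N) / ln (real N) < b + \<kappa> / 2"
    "\<forall>\<^sub>F N in sequentially. ln (q N) / ln (real N) > b - \<kappa> / 2"
    using lim \<open>\<kappa> > 0\<close> by (auto intro: order_tendstoD)
  have exq: "real N powr x = exp (x * ln (real N))" if "real N \<ge> 2" for N x
    using that by (simp add: powr_def)
  show "\<forall>\<^sub>F N in sequentially. 2 * (real N * q N) \<le> real N powr (1 + b + \<kappa>)"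
    using N e(1) pos
  proof eventually_elim
    case (elim N)
    then have "ln (q N) \<le> (b + \<kappa> / 2) * ln (real N)"
      by (simp add: field_simps)
    then have "q N \<le> real N powr (b + \<kappa> / 2)"
      using elim by (metis exq exp_le_cancel_iff exp_ln)
    then have "2 * (real N * q N) \<le> real N powr (\<kappa> / 2) * (real N powr 1 * real N powr (b + \<kappa> / 2))"
      using elim by (intro mult_mono) auto
    also have "\<dots> = real N powr (1 + b + \<kappa>)"
      by (simp only: powr_add[symmetric]) (simp add: algebra_simps)
    finally show ?case .
  qed
  show "\<forall>\<^sub>F N in sequentially. 2 * real N powr (1 + b - \<kappa>) \<le> real N * q N"
    using N e(2) pos
  proof eventually_elim
    case (elim N)
    then have "ln (q N) \<ge> (b - \<kappa> / 2) * ln (real N)"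
      by (simp add: field_simps)
    then have q: "q N \<ge> real N powr (b - \<kappa> / 2)"
      using elim by (metis exq exp_le_cancel_iff exp_ln)
    have "2 * real N powr (1 + b - \<kappa>) \<le> real N powr (\<kappa> / 2) * real N powr (1 + b - \<kappa>)"
      using elim by (intro mult_right_mono) auto
    also have "\<dots> = real N powr 1 * real N powr (b - \<kappa> / 2)"
      by (simp only: powr_add[symmetric]) (simp add: algebra_simps)
    also have "\<dots> \<le> real N * q N"
      using q elim by (intro mult_mono) auto
    finally show ?case .
  qed
qed

subsection \<open>A dominant last player\<close>

text \<open>The sum runs over all \<open>j\<close>, so for \<open>x = V i\<close> it contains a
  fictitious game of player \<open>i\<close> against himself. In return it is one monotone function
  of the strength, common to all players.\<close>

definition mean_score :: "nat \<Rightarrow> (nat \<Rightarrow> real) \<Rightarrow> real \<Rightarrow> real" where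
  "mean_score N V x = (\<Sum>j=1..N. x / (x + V j))"

text \<open>Both the derivative of \<open>mean_score N V\<close> at 1 and the variance of the score
  at strength 1, left unnormalised; divided by \<open>N\<close> it is the empirical version of
  \<theta>.\<close>

definition drift :: "nat \<Rightarrow> (nat \<Rightarrow> real) \<Rightarrow> real" where
  "drift N V = (\<Sum>j=1..N. V j / (V j + 1)\<^sup>2)"

lemma win_prob_mono: "0 < x \<Longrightarrow> x \<le> y \<Longrightarrow> 0 < w \<Longrightarrow> x / (x + w) \<le> y / (y + w)" for w x y :: real
  by (simp add: field_simps)

text \<open>The variance equals \<open>x * w / (x + w)^2\<close>, and
  \<open>x * (w + 1) <= x + w <= 1 + w\<close> for \<open>x <= 1\<close>.\<close>

lemma win_var_bounds:
  fixes w x h :: real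
  assumes "0 < w" "0 \<le> h" "h < 1" "1 - h \<le> x" "x \<le> 1"
  shows "x / (x + w) * (1 - x / (x + w)) \<le> w / (w + 1)\<^sup>2 / (1 - h)"
    and "(1 - h) * (w / (w + 1)\<^sup>2) \<le> x / (x + w) * (1 - x / (x + w))"
proof -
  have x: "x > 0" using assms by linarith
  have eq: "x / (x + w) * (1 - x / (x + w)) = x * w / (x + w)\<^sup>2"
    using x assms by (simp add: field_simps power2_eq_square)
  have "x * w \<le> 1 * w" using assms by (intro mult_right_mono) auto
  then have "x * (w + 1) \<le> x + w" using assms by (simp add: algebra_simps)
  then have "(x * (w + 1))\<^sup>2 \<le> (x + w)\<^sup>2" using x assms by (intro power_mono) auto
  then have "x * w / (x + w)\<^sup>2 \<le> x * w / (x * (w + 1))\<^sup>2"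
    using x assms by (intro divide_left_mono) auto
  also have "\<dots> = w / (w + 1)\<^sup>2 / x"
    using x by (simp add: power2_eq_square)
  also have "\<dots> \<le> w / (w + 1)\<^sup>2 / (1 - h)"
    using x assms by (intro divide_left_mono) auto
  finally show "x / (x + w) * (1 - x / (x + w)) \<le> w / (w + 1)\<^sup>2 / (1 - h)"
    using eq by simp
  have "(1 - h) * (w / (w + 1)\<^sup>2) \<le> x * (w / (w + 1)\<^sup>2)"
    using assms by (intro mult_right_mono) auto
  also have "\<dots> = x * w / (w + 1)\<^sup>2" by simp
  also have "\<dots> \<le> x * w / (x + w)\<^sup>2"
    using x assms by (intro divide_left_mono power_mono mult_pos_pos zero_less_power) auto
  finally show "(1 - h) * (w / (w + 1)\<^sup>2) \<le> x / (x + w) * (1 - x / (x + w))"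
    using eq by simp
qed

text \<open>The increment is exactly \<open>h * w / ((1 + h + w) * (w + 1))\<close>, and
  \<open>1 + h + w\<close> lies between \<open>1 + w\<close> and \<open>(1 + h) * (1 + w)\<close>.
  The version for a decrement below uses the same identity with \<open>- h\<close>.\<close>

lemma win_prob_up:
  fixes w h :: real
  assumes "0 < w" "0 \<le> h"
  shows "(1 + h) / (1 + h + w) \<le> 1 / (1 + w) + h * (w / (w + 1)\<^sup>2)"
    and "1 / (1 + w) + h / (1 + h) * (w / (w + 1)\<^sup>2) \<le> (1 + h) / (1 + h + w)"
proof -
  have eq: "(1 + h) / (1 + h + w) = 1 / (1 + w) + h * w / ((1 + h + w) * (w + 1))"
    using assms by (simp add: divide_simps) (simp add: algebra_simps)
  have "h * w / ((1 + h + w) * (w + 1)) \<le> h * w / (w + 1)\<^sup>2"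
    using assms unfolding power2_eq_square by (intro divide_left_mono mult_right_mono mult_pos_pos) auto
  with eq show "(1 + h) / (1 + h + w) \<le> 1 / (1 + w) + h * (w / (w + 1)\<^sup>2)" by simp
  have "1 + h + w \<le> (1 + h) * (w + 1)" using assms by (simp add: algebra_simps)
  then have "h * w / ((1 + h) * (w + 1) * (w + 1)) \<le> h * w / ((1 + h + w) * (w + 1))"
    using assms by (intro divide_left_mono mult_right_mono mult_pos_pos) auto
  with eq show "1 / (1 + w) + h / (1 + h) * (w / (w + 1)\<^sup>2) \<le> (1 + h) / (1 + h + w)"
    by (simp add: power2_eq_square mult.assoc)
qed

lemma win_prob_down:
  fixes w h :: real
  assumes "0 < w" "0 \<le> h" "h < 1"
  shows "(1 - h) / (1 - h + w) \<le> 1 / (1 + w) - h * (w / (w + 1)\<^sup>2)"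
    and "1 / (1 + w) - h / (1 - h) * (w / (w + 1)\<^sup>2) \<le> (1 - h) / (1 - h + w)"
proof -
  have pos: "1 - h + w > 0" using assms by linarith
  have eq: "(1 - h) / (1 - h + w) = 1 / (1 + w) - h * w / ((1 - h + w) * (w + 1))"
    using assms pos by (simp add: divide_simps) (simp add: algebra_simps)
  have "h * w / (w + 1)\<^sup>2 \<le> h * w / ((1 - h + w) * (w + 1))"
    using assms pos unfolding power2_eq_square by (intro divide_left_mono mult_right_mono mult_pos_pos) auto
  with eq show "(1 - h) / (1 - h + w) \<le> 1 / (1 + w) - h * (w / (w + 1)\<^sup>2)" by simp
  have "(1 - h) * (w + 1) \<le> 1 - h + w" using assms by (simp add: algebra_simps)
  then have "h * w / ((1 - h + w) * (w + 1)) \<le> h * w / ((1 - h) * (w + 1) * (w + 1))"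
    using assms pos by (intro divide_left_mono mult_right_mono mult_pos_pos) auto
  with eq show "1 / (1 + w) - h / (1 - h) * (w / (w + 1)\<^sup>2) \<le> (1 - h) / (1 - h + w)"
    by (simp add: power2_eq_square mult.assoc)
qed

text \<open>Deterministic strengths for one \<open>N\<close>. The bound by 1 concerns the players of
  the sample only; the last player may be stronger.\<close>

locale strength_profile =
  fixes N :: nat and V :: "nat \<Rightarrow> real"
  assumes V_pos: "k \<in> {1..N+1} \<Longrightarrow> 0 < V k" and V_le: "k \<in> {1..N} \<Longrightarrow> V k \<le> 1"
begin

abbreviation "F \<equiv> mean_score N V"
abbreviation "D \<equiv> drift N V"
abbreviation "P \<equiv> measure_pmf.prob (tournament N V)"

lemma V_pos': "k \<in> {1..N} \<Longrightarrow> 0 < V k"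
  by (rule V_pos) auto

lemma F_mono: "0 < x \<Longrightarrow> x \<le> y \<Longrightarrow> F x \<le> F y"
  unfolding mean_score_def by (intro sum_mono win_prob_mono V_pos')

lemma D_nonneg: "0 \<le> D"
  unfolding drift_def using V_pos' by (intro sum_nonneg divide_nonneg_nonneg) (auto intro: less_imp_le)

lemma F_up: "0 \<le> h \<Longrightarrow> F (1 + h) \<le> F 1 + h * D" "0 \<le> h \<Longrightarrow> F 1 + h / (1 + h) * D \<le> F (1 + h)"
  unfolding mean_score_def drift_def sum_distrib_left sum.distrib[symmetric]
  by (intro sum_mono win_prob_up V_pos'; assumption)+

lemma F_down: "0 \<le> h \<Longrightarrow> h < 1 \<Longrightarrow> F (1 - h) \<le> F 1 - h * D"
    "0 \<le> h \<Longrightarrow> h < 1 \<Longrightarrow> F 1 - h / (1 - h) * D \<le> F (1 - h)"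
  unfolding mean_score_def drift_def sum_distrib_left sum_subtractf[symmetric]
  by (intro sum_mono win_prob_down V_pos'; assumption)+

lemma Xres_bernoulli:
  "i \<in> {1..N+1} \<Longrightarrow> B \<subseteq> {1..N} - {i} \<Longrightarrow>
    indep_bernoulli (measure_pmf (tournament N V)) B (\<lambda>j x. real (Xres x i j)) (\<lambda>j. V i / (V i + V j))"
  by (intro indep_bernoulli_Xres V_pos) auto

lemma mean_le_F:
  assumes "i \<in> {1..N+1}"
  shows "(\<Sum>j\<in>{1..N} - {i}. V i / (V i + V j)) \<le> F (V i)"
  unfolding mean_score_def using V_pos[OF assms] V_pos'
  by (intro sum_mono2) (auto intro!: divide_nonneg_nonneg add_nonneg_nonneg less_imp_le)

lemma var_le_D:
  assumes "i \<in> {1..N}" "B \<subseteq> {1..N}" "0 \<le> h" "h < 1" "1 - h \<le> V i"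
  shows "(\<Sum>j\<in>B. V i / (V i + V j) * (1 - V i / (V i + V j))) \<le> D / (1 - h)"
proof -
  have "(\<Sum>j\<in>B. V i / (V i + V j) * (1 - V i / (V i + V j))) \<le> (\<Sum>j\<in>B. V j / (V j + 1)\<^sup>2 / (1 - h))"
    using assms V_pos' V_le by (intro sum_mono win_var_bounds) auto
  also have "\<dots> \<le> (\<Sum>j=1..N. V j / (V j + 1)\<^sup>2 / (1 - h))"
    using assms V_pos' by (intro sum_mono2 divide_nonneg_nonneg) (auto intro: less_imp_le)
  also have "\<dots> = D / (1 - h)"
    by (simp add: drift_def sum_divide_distrib)
  finally show ?thesis .
qed

text \<open>These are the players who decide the threshold, so the Chernoff bound is used with their
  true variance, which is \<open>D\<close> up to the factor \<open>1 / (1 - h)\<close>.\<close>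

lemma prob_score_ge_top:
  assumes i: "i \<in> {1..N}" and h: "0 \<le> h" "h < 1" "1 - h \<le> V i" and l: "0 < l" "l \<le> 1"
  shows "P {x. real (score N x i) \<ge> F 1 + t} \<le> exp (- l * t + l\<^sup>2 / 2 * (1 + l) * (D / (1 - h)))"
proof -
  let ?B = "{1..N} - {i}" and ?p = "\<lambda>j. V i / (V i + V j)"
  interpret indep_bernoulli "measure_pmf (tournament N V)" ?B "\<lambda>j x. real (Xres x i j)" ?p
    using i by (intro Xres_bernoulli) auto
  have "sum ?p ?B \<le> F (V i)" using i by (intro mean_le_F) auto
  also have "\<dots> \<le> F 1" using i V_le V_pos' by (intro F_mono) auto
  finally have "P {x. real (score N x i) \<ge> F 1 + t}
      \<le> P {x \<in> space (measure_pmf (tournament N V)). (\<Sum>j\<in>?B. real (Xres x i j)) \<ge> sum ?p ?B + t}"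
    by (intro measure_pmf.finite_measure_mono) (auto simp: score_def)
  also have "\<dots> \<le> exp (- l * t + l\<^sup>2 / 2 * (1 + l) * (\<Sum>j\<in>?B. ?p j * (1 - ?p j)))"
    by (rule chernoff_ge[OF l])
  also have "\<dots> \<le> exp (- l * t + l\<^sup>2 / 2 * (1 + l) * (D / (1 - h)))"
    using var_le_D[OF i _ h, of ?B] l
    by (intro exp_le_cancel_iff[THEN iffD2] add_left_mono mult_left_mono) auto
  finally show ?thesis .
qed

text \<open>A player weaker by \<open>h\<close> has a mean lower by at least \<open>h * D\<close>.
  Since \<open>h\<close> will be a large multiple of \<epsilon>, Hoeffding's cruder constant is
  enough.\<close>

lemma prob_score_ge_bottom:
  assumes i: "i \<in> {1..N}" and h: "0 \<le> h" "h < 1" "V i \<le> 1 - h"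
  shows "P {x. real (score N x i) \<ge> F 1} \<le> exp (- 2 * (h * D)\<^sup>2 / N)"
proof -
  let ?B = "{1..N} - {i}" and ?p = "\<lambda>j. V i / (V i + V j)"
  interpret indep_bernoulli "measure_pmf (tournament N V)" ?B "\<lambda>j x. real (Xres x i j)" ?p
    using i by (intro Xres_bernoulli) auto
  have "sum ?p ?B \<le> F (V i)" using i by (intro mean_le_F) auto
  also have "\<dots> \<le> F (1 - h)" using i h V_pos' by (intro F_mono) auto
  also have "\<dots> \<le> F 1 - h * D" using h by (intro F_down)
  finally have "P {x. real (score N x i) \<ge> F 1}
      \<le> P {x \<in> space (measure_pmf (tournament N V)). (\<Sum>j\<in>?B. real (Xres x i j)) \<ge> sum ?p ?B + h * D}"
    by (intro measure_pmf.finite_measure_mono) (auto simp: score_def)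
  also have "\<dots> \<le> exp (- 2 * (h * D)\<^sup>2 / N)"
    using h D_nonneg card_mono[of "{1..N}" ?B] by (intro hoeffding_ge) auto
  finally show ?thesis .
qed

text \<open>Only one player is involved and no union bound follows, so any deviation of order
  \<epsilon> times \<open>N\<close> is already improbable by Hoeffding. The same holds for the
  opposite tail below.\<close>

lemma prob_last_le:
  assumes h: "0 \<le> h" "1 + h \<le> V (N+1)" and t: "0 \<le> t"
  shows "P {x. real (score N x (N+1)) \<le> F 1 + h / (1 + h) * D - t} \<le> exp (- 2 * t\<^sup>2 / N)"
proof -
  let ?B = "{1..N}" and ?p = "\<lambda>j. V (N+1) / (V (N+1) + V j)"
  interpret indep_bernoulli "measure_pmf (tournament N V)" ?B "\<lambda>j x. real (Xres x (N+1) j)" ?p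
    by (intro Xres_bernoulli) auto
  have "F 1 + h / (1 + h) * D \<le> F (1 + h)" using h by (intro F_up)
  also have "\<dots> \<le> F (V (N+1))" using h by (intro F_mono) auto
  also have "\<dots> = sum ?p ?B" by (simp add: mean_score_def)
  finally have le: "F 1 + h / (1 + h) * D \<le> sum ?p ?B" .
  have "P {x. real (score N x (N+1)) \<le> F 1 + h / (1 + h) * D - t}
      \<le> P {x \<in> space (measure_pmf (tournament N V)). (\<Sum>j\<in>?B. real (Xres x (N+1) j)) \<le> sum ?p ?B - t}"
    using le by (intro measure_pmf.finite_measure_mono) (auto simp: score_def)
  also have "\<dots> \<le> exp (- 2 * t\<^sup>2 / N)"
    using t by (intro hoeffding_le) auto
  finally show ?thesis .
qed

lemma prob_last_ge:
  assumes h: "0 \<le> h" "V (N+1) \<le> 1 + h" and t: "0 \<le> t"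
  shows "P {x. real (score N x (N+1)) \<ge> F 1 + h * D + t} \<le> exp (- 2 * t\<^sup>2 / N)"
proof -
  let ?B = "{1..N}" and ?p = "\<lambda>j. V (N+1) / (V (N+1) + V j)"
  interpret indep_bernoulli "measure_pmf (tournament N V)" ?B "\<lambda>j x. real (Xres x (N+1) j)" ?p
    by (intro Xres_bernoulli) auto
  have "sum ?p ?B = F (V (N+1))" by (simp add: mean_score_def)
  also have "\<dots> \<le> F (1 + h)" using h V_pos by (intro F_mono) auto
  also have "\<dots> \<le> F 1 + h * D" using h by (intro F_up)
  finally have le: "sum ?p ?B \<le> F 1 + h * D" .
  have "P {x. real (score N x (N+1)) \<ge> F 1 + h * D + t}
      \<le> P {x \<in> space (measure_pmf (tournament N V)). (\<Sum>j\<in>?B. real (Xres x (N+1) j)) \<ge> sum ?p ?B + t}"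
    using le by (intro measure_pmf.finite_measure_mono) (auto simp: score_def)
  also have "\<dots> \<le> exp (- 2 * t\<^sup>2 / N)"
    using t by (intro hoeffding_ge) auto
  finally show ?thesis .
qed

text \<open>The level \<open>F 1 + t\<close> separates the two sides: if no player of the sample
  reaches it and the last player exceeds it by more than 1, the lead over the maximum is more than
  1. The union bound then treats strengths above and below \<open>1 - h\<close> differently.\<close>

lemma prob_not_last_ahead_le:
  assumes N: "N \<ge> 1" and h: "0 \<le> h" "h < 1" and t: "0 \<le> t" and l: "0 < l" "l \<le> 1"
  shows "P {x. \<not> real (score N x (N+1)) > 1 + real (Max (score N x ` {1..N}))}
    \<le> P {x. real (score N x (N+1)) \<le> F 1 + t + 1}
      + (\<Sum>i=1..N. of_bool (V i > 1 - h)) * exp (- l * t + l\<^sup>2 / 2 * (1 + l) * (D / (1 - h)))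
      + real N * exp (- 2 * (h * D)\<^sup>2 / N)"
proof -
  let ?b1 = "exp (- l * t + l\<^sup>2 / 2 * (1 + l) * (D / (1 - h)))" and ?b2 = "exp (- 2 * (h * D)\<^sup>2 / N)"
  have "{x. \<not> real (score N x (N+1)) > 1 + real (Max (score N x ` {1..N}))}
      \<subseteq> {x. real (score N x (N+1)) \<le> F 1 + t + 1} \<union> (\<Union>i\<in>{1..N}. {x. real (score N x i) \<ge> F 1 + t})"
  proof
    fix x assume x: "x \<in> {x. \<not> real (score N x (N+1)) > 1 + real (Max (score N x ` {1..N}))}"
    have "Max (score N x ` {1..N}) \<in> score N x ` {1..N}" using N by (intro Max_in) auto
    then obtain i where i: "i \<in> {1..N}" "Max (score N x ` {1..N}) = score N x i" by auto
    then show "x \<in> {x. real (score N x (N+1)) \<le> F 1 + t + 1} \<union> (\<Union>i\<in>{1..N}. {x. real (score N x i) \<ge> F 1 + t})"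
      using x by (cases "real (score N x i) \<ge> F 1 + t") auto
  qed
  then have "P {x. \<not> real (score N x (N+1)) > 1 + real (Max (score N x ` {1..N}))}
      \<le> P ({x. real (score N x (N+1)) \<le> F 1 + t + 1} \<union> (\<Union>i\<in>{1..N}. {x. real (score N x i) \<ge> F 1 + t}))"
    by (intro measure_pmf.finite_measure_mono) auto
  also have "\<dots> \<le> P {x. real (score N x (N+1)) \<le> F 1 + t + 1} + P (\<Union>i\<in>{1..N}. {x. real (score N x i) \<ge> F 1 + t})"
    by (intro measure_Un_le) auto
  also have "P (\<Union>i\<in>{1..N}. {x. real (score N x i) \<ge> F 1 + t}) \<le> (\<Sum>i=1..N. P {x. real (score N x i) \<ge> F 1 + t})"
    by (intro measure_pmf.finite_measure_subadditive_finite) auto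
  \<comment> \<open>Charging \<open>?b2\<close> to every player, including the strong ones, only
    enlarges the bound and gives the plain factor \<open>N\<close>.\<close>
  also have "\<dots> \<le> (\<Sum>i=1..N. of_bool (V i > 1 - h) * ?b1 + ?b2)"
  proof (intro sum_mono)
    fix i assume i: "i \<in> {1..N}"
    show "P {x. real (score N x i) \<ge> F 1 + t} \<le> of_bool (V i > 1 - h) * ?b1 + ?b2"
    proof (cases "V i > 1 - h")
      case True
      then show ?thesis using prob_score_ge_top[OF i h _ l, of t] by (simp add: add_increasing2)
    next
      case False
      have "P {x. real (score N x i) \<ge> F 1 + t} \<le> P {x. real (score N x i) \<ge> F 1}"
        using t by (intro measure_pmf.finite_measure_mono) auto
      then show ?thesis using prob_score_ge_bottom[OF i h] False by simp
    qed
  qed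
  also have "\<dots> = (\<Sum>i=1..N. of_bool (V i > 1 - h)) * ?b1 + real N * ?b2"
    by (simp only: sum.distrib sum_distrib_right) simp
  finally show ?thesis by (simp add: add_ac)
qed

end

lemma prob_eq_1_minus_not: "measure_pmf.prob p {x. E x} = 1 - measure_pmf.prob p {x. \<not> E x}"
proof -
  have "{x. \<not> E x} = space (measure_pmf p) - {x. E x}" by auto
  then show ?thesis using measure_pmf.prob_compl[of "{x. E x}" p] by simp
qed

text \<open>Collects almost sure properties of one realisation \<open>w\<close> of the sample, after
  which the argument is deterministic in the strengths. The counts of players near 1 depend on
  further constants and enter as hypotheses of the two limit lemmas.\<close>

locale environment =
  fixes w :: "nat \<Rightarrow> real" and \<theta> \<alpha> :: real and \<epsilon> :: "nat \<Rightarrow> real" and v :: "nat \<Rightarrow> real"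
  assumes w_pos: "k \<ge> 1 \<Longrightarrow> 0 < w k" and w_le: "k \<ge> 1 \<Longrightarrow> w k \<le> 1"
    and theta: "0 < \<theta>" and alpha: "\<alpha> < 2"
    and eps: "\<epsilon> N = sqrt ((2 - \<alpha>) / \<theta> * (ln (real N) / real N))"
    and lln: "(\<lambda>N. (\<Sum>k=1..N. w k / (w k + 1)\<^sup>2) / real N) \<longlonglongrightarrow> \<theta>"
    and v_pos: "N \<ge> 1 \<Longrightarrow> 0 < v (N+1)"
begin

abbreviation V :: "nat \<Rightarrow> nat \<Rightarrow> real" where
  "V N \<equiv> strengths N w (v (N+1))"

lemma strength_profile_V: "N \<ge> 1 \<Longrightarrow> strength_profile N (V N)"
proof
  assume N: "N \<ge> 1"
  show "V N k \<le> 1" if "k \<in> {1..N}" for k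
    using strengths_mem[OF that, of w "v (N+1)"] w_le by auto
  show "0 < V N k" if "k \<in> {1..N+1}" for k
  proof (cases "k \<le> N")
    case True
    then show ?thesis using strengths_mem[of k N w "v (N+1)"] w_pos that by auto
  next
    case False
    then show ?thesis using v_pos[OF N] that by (simp add: strengths_def)
  qed
qed

lemma V_last: "V N (N+1) = v (N+1)"
  by (simp add: strengths_def)

text \<open>The calibration of \<epsilon>: every quadratic exponent becomes a multiple of
  \<open>ln (real N)\<close>, hence a power of \<open>N\<close>.\<close>

lemma eps_sq: "N \<ge> 1 \<Longrightarrow> (\<epsilon> N)\<^sup>2 * (real N * \<theta>) = (2 - \<alpha>) * ln (real N)"
  using theta alpha by (simp add: eps)

lemma eps_pos: "N \<ge> 2 \<Longrightarrow> \<epsilon> N > 0"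
  using theta alpha by (simp add: eps)

lemma eps_tendsto_0: "\<epsilon> \<longlonglongrightarrow> 0"
proof -
  have "(\<lambda>N. sqrt (c * (ln (real N) / real N))) \<longlonglongrightarrow> 0" for c
    using tendsto_real_sqrt[OF tendsto_mult[OF tendsto_const[of c] lim_ln_over_n]] by simp
  then show ?thesis unfolding eps[abs_def] .
qed

lemma eps_N_at_top: "filterlim (\<lambda>N. \<epsilon> N * real N) at_top sequentially"
proof -
  have "filterlim (\<lambda>N. sqrt (c * (ln (real N) / real N)) * real N) at_top sequentially" if "c > 0" for c
    using that by real_asymp
  from this[of "(2 - \<alpha>) / \<theta>"] show ?thesis unfolding eps using theta alpha by simp
qed

lemma drift_V: "drift N (V N) = (\<Sum>k=1..N. w k / (w k + 1)\<^sup>2)"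
  unfolding drift_def by (rule sum_strengths)

lemma drift_tendsto: "(\<lambda>N. drift N (V N) / (real N * \<theta>)) \<longlonglongrightarrow> 1"
  using tendsto_divide[OF lln tendsto_const[of \<theta>]] theta unfolding drift_V by simp

lemma ln_exponent: "N \<ge> 1 \<Longrightarrow> exp (- c * ln (real N)) = real N powr (- c)"
  by (simp add: powr_def)

text \<open>A player near 1 reaches the level with probability at most
  \<open>N powr (- ((1 + \<delta>) * (2 - \<alpha>) / 2))\<close>. This beats their number by the
  power \<open>\<delta> * (2 - \<alpha>) / 4\<close>. The condition on \<open>K\<close> makes each
  remaining player contribute at most \<open>N powr (- 2)\<close>.\<close>

lemma last_player_ahead:
  assumes d: "\<delta> > 0" and K: "0 < K" "4 \<le> K\<^sup>2 * \<theta> * (2 - \<alpha>)"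
    and count: "\<forall>\<^sub>F N in sequentially. (\<Sum>k=1..N. of_bool (w k > 1 - K * \<epsilon> N)) \<le> real N powr ((2 - \<alpha>) / 2 + \<delta> * (2 - \<alpha>) / 4)"
    and v: "\<forall>\<^sub>F N in sequentially. 1 + (1 + 3 * \<delta>) * \<epsilon> N \<le> v (N+1)"
  shows "(\<lambda>N. qprob N w (v (N+1)) (\<lambda>x. real (score N x (N+1)) > 1 + real (Max (score N x ` {1..N})))) \<longlonglongrightarrow> 1"
proof -
  define c where "c = 2 - \<alpha>"
  have c: "c > 0" using alpha by (simp add: c_def)
  define bad where "bad N = measure_pmf.prob (tournament N (V N))
    {x. \<not> real (score N x (N+1)) > 1 + real (Max (score N x ` {1..N}))}" for N
  have qp: "qprob N w (v (N+1)) (\<lambda>x. real (score N x (N+1)) > 1 + real (Max (score N x ` {1..N}))) = 1 - bad N" for N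
    unfolding bad_def qprob_def by (rule prob_eq_1_minus_not)
  have l1: "(\<lambda>N. (1 + (1 + \<delta>) * \<epsilon> N) * (drift N (V N) / (real N * \<theta>)) / (1 - K * \<epsilon> N)) \<longlonglongrightarrow> (1 + (1 + \<delta>) * 0) * 1 / (1 - K * 0)"
    by (intro tendsto_intros eps_tendsto_0 drift_tendsto) auto
  have l2: "(\<lambda>N. (1 + 3 * \<delta>) * (drift N (V N) / (real N * \<theta>)) / (1 + (1 + 3 * \<delta>) * \<epsilon> N)) \<longlonglongrightarrow> (1 + 3 * \<delta>) * 1 / (1 + (1 + 3 * \<delta>) * 0)"
    by (intro tendsto_intros eps_tendsto_0 drift_tendsto) auto
  \<comment> \<open>The tolerance is chosen so that
    \<open>(1 + \<delta>)^2 * (1 - \<delta> / (1 + \<delta>))\<close> is exactly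
    \<open>1 + \<delta>\<close>.\<close>
  have ev1: "\<forall>\<^sub>F N in sequentially. (1 + (1 + \<delta>) * \<epsilon> N) * (drift N (V N) / (real N * \<theta>)) / (1 - K * \<epsilon> N) < 1 + \<delta> / (1 + \<delta>)"
    using order_tendstoD(2)[OF l1, of "1 + \<delta> / (1 + \<delta>)"] d by simp
  \<comment> \<open>Linearising the mean of the last player costs one \<delta> out of the three
    available.\<close>
  have ev2: "\<forall>\<^sub>F N in sequentially. 1 + 2 * \<delta> < (1 + 3 * \<delta>) * (drift N (V N) / (real N * \<theta>)) / (1 + (1 + 3 * \<delta>) * \<epsilon> N)"
    using order_tendstoD(1)[OF l2, of "1 + 2 * \<delta>"] d by simp
  have ev3: "\<forall>\<^sub>F N in sequentially. 1 / 2 < drift N (V N) / (real N * \<theta>)"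
    using order_tendstoD(1)[OF drift_tendsto, of "1 / 2"] by simp
  have ev4: "\<forall>\<^sub>F N in sequentially. K * \<epsilon> N < 1"
    using order_tendstoD(2)[OF tendsto_mult[OF tendsto_const[of K] eps_tendsto_0], of 1] by simp
  have ev5: "\<forall>\<^sub>F N in sequentially. (1 + \<delta>) * \<epsilon> N < 1"
    using order_tendstoD(2)[OF tendsto_mult[OF tendsto_const[of "1 + \<delta>"] eps_tendsto_0], of 1] by simp
  have ev6: "\<forall>\<^sub>F N in sequentially. 2 / (\<delta> * \<theta>) \<le> \<epsilon> N * real N"
    using eps_N_at_top unfolding filterlim_at_top by blast
  have "\<forall>\<^sub>F N in sequentially. bad N \<le> real N powr (- (\<delta>\<^sup>2 * \<theta> * c / 2)) + real N powr (- (\<delta> * c / 4)) + real N powr (- 1)"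
    using ev1 ev2 ev3 ev4 ev5 ev6 count v eventually_ge_at_top[of 2]
  proof eventually_elim
    case (elim N)
    then have N: "N \<ge> 1" "N \<ge> 2" "real N > 0" by auto
    interpret strength_profile N "V N" by (rule strength_profile_V[OF N(1)])
    define e where "e = \<epsilon> N"
    have e: "e > 0" using eps_pos[OF N(2)] by (simp add: e_def)
    have esq: "e\<^sup>2 * (real N * \<theta>) = c * ln (real N)"
      using eps_sq[OF N(1)] by (simp add: e_def c_def)
    have Nt: "real N * \<theta> > 0" using N theta by simp
    have lnN: "ln (real N) > 0" using N by simp
    \<comment> \<open>The level lies \<open>1 + \<delta>\<close> units of
      \<open>e * (real N * \<theta>)\<close> above \<open>F 1\<close>, and \<open>l\<close> is
      \<open>t\<close> divided by the asymptotic variance \<open>real N * \<theta>\<close>, the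
      optimal choice for a Gaussian tail.\<close>
    define t where "t = (1 + \<delta>) * e * (real N * \<theta>)"
    define l where "l = (1 + \<delta>) * e"
    have t: "0 \<le> t" using e d Nt by (simp add: t_def)
    have l: "0 < l" "l \<le> 1" using e d elim by (auto simp: l_def e_def)
    have h: "0 \<le> K * e" "K * e < 1" using e K elim by (auto simp: e_def)
    have b1: "exp (- l * t + l\<^sup>2 / 2 * (1 + l) * (D / (1 - K * e))) \<le> real N powr (- ((1 + \<delta>) * c / 2))"
    proof -
      have "(1 + l) * (D / (1 - K * e)) = (1 + (1 + \<delta>) * \<epsilon> N) * (D / (real N * \<theta>)) / (1 - K * \<epsilon> N) * (real N * \<theta>)"
        using N theta by (simp add: l_def e_def)
      also have "\<dots> \<le> (1 + \<delta> / (1 + \<delta>)) * (real N * \<theta>)"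
        using elim Nt by (intro mult_right_mono) auto
      finally have a1: "l\<^sup>2 / 2 * ((1 + l) * (D / (1 - K * e))) \<le> l\<^sup>2 / 2 * ((1 + \<delta> / (1 + \<delta>)) * (real N * \<theta>))"
        by (intro mult_left_mono) auto
      have a2: "- l * t + l\<^sup>2 / 2 * ((1 + \<delta> / (1 + \<delta>)) * (real N * \<theta>))
          = - ((1 + \<delta>)\<^sup>2 / 2 * (1 - \<delta> / (1 + \<delta>))) * (e\<^sup>2 * (real N * \<theta>))"
      proof -
        have "- l * ((1 + \<delta>) * e * m) + l\<^sup>2 / 2 * ((1 + g) * m) = - ((1 + \<delta>)\<^sup>2 / 2 * (1 - g)) * (e\<^sup>2 * m)" for g m
          by (simp add: l_def power2_eq_square field_simps)
        then show ?thesis unfolding t_def .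
      qed
      have a3: "(1 + \<delta>)\<^sup>2 / 2 * (1 - \<delta> / (1 + \<delta>)) = (1 + \<delta>) / 2"
        using d by (simp add: power2_eq_square field_simps)
      have "- l * t + l\<^sup>2 / 2 * ((1 + l) * (D / (1 - K * e))) \<le> - ((1 + \<delta>) / 2) * (c * ln (real N))"
        using a1 a2[unfolded a3 esq] by linarith
      then have "- l * t + l\<^sup>2 / 2 * (1 + l) * (D / (1 - K * e)) \<le> - ((1 + \<delta>) * c / 2) * ln (real N)"
        by (simp only: mult.assoc mult_minus_left times_divide_eq_left times_divide_eq_right)
      then have "exp (- l * t + l\<^sup>2 / 2 * (1 + l) * (D / (1 - K * e))) \<le> exp (- ((1 + \<delta>) * c / 2) * ln (real N))"
        by (rule exp_le_cancel_iff[THEN iffD2])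
      then show ?thesis unfolding ln_exponent[OF N(1)] .
    qed
    have b2: "exp (- 2 * (K * e * D)\<^sup>2 / N) \<le> real N powr (- 2)"
    proof -
      have "real N * \<theta> / 2 \<le> D" using elim Nt by (simp add: field_simps)
      then have "(real N * \<theta> / 2)\<^sup>2 \<le> D\<^sup>2" using Nt by (intro power_mono) auto
      then have "(K * e)\<^sup>2 * (real N * \<theta> / 2)\<^sup>2 \<le> (K * e)\<^sup>2 * D\<^sup>2" by (intro mult_left_mono) auto
      then have "2 * ((K * e)\<^sup>2 * (real N * \<theta> / 2)\<^sup>2) / N \<le> 2 * ((K * e)\<^sup>2 * D\<^sup>2) / N"
        by (intro divide_right_mono) linarith+
      moreover have "2 * ((K * e)\<^sup>2 * (real N * \<theta> / 2)\<^sup>2) / N = K\<^sup>2 * \<theta> / 2 * (e\<^sup>2 * (real N * \<theta>))"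
        using N by (simp add: power2_eq_square field_simps)
      \<comment> \<open>The constant 4 in the hypothesis on \<open>K\<close> yields the exponent 2,
        enough to survive a sum over \<open>N\<close> players.\<close>
      moreover have "2 * ln (real N) \<le> K\<^sup>2 * \<theta> / 2 * (c * ln (real N))"
        using mult_right_mono[OF K(2), of "ln (real N)"] lnN by (simp add: c_def)
      ultimately have "- 2 * (K * e * D)\<^sup>2 / N \<le> - 2 * ln (real N)"
        unfolding esq by (simp add: power_mult_distrib)
      then have "exp (- 2 * (K * e * D)\<^sup>2 / N) \<le> exp (- 2 * ln (real N))" by (rule exp_le_cancel_iff[THEN iffD2])
      then show ?thesis unfolding ln_exponent[OF N(1)] .
    qed
    have b3: "P {x. real (score N x (N+1)) \<le> F 1 + t + 1} \<le> real N powr (- (\<delta>\<^sup>2 * \<theta> * c / 2))"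
    proof -
      define h where "h = (1 + 3 * \<delta>) * e"
      \<comment> \<open>The last player's mean exceeds the level by \<delta> units. Half of this
        absorbs the random fluctuation; the other half covers the required extra point, by the lower
        bound on \<open>\<epsilon> N * real N\<close>.\<close>
      define s where "s = \<delta> / 2 * (e * (real N * \<theta>))"
      have h: "0 \<le> h" "1 + h \<le> V N (N+1)"
        using e d elim unfolding V_last by (auto simp: h_def e_def)
      have s: "0 \<le> s" using e d Nt by (simp add: s_def)
      have "1 \<le> s"
        using elim d theta by (simp add: s_def e_def field_simps)
      have "h / (1 + h) * D = (1 + 3 * \<delta>) * (D / (real N * \<theta>)) / (1 + (1 + 3 * \<delta>) * \<epsilon> N) * (e * (real N * \<theta>))"
        using Nt N theta by (simp add: h_def e_def)
      also have "\<dots> \<ge> (1 + 2 * \<delta>) * (e * (real N * \<theta>))"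
        using elim e Nt by (intro mult_right_mono) auto
      finally have "F 1 + t + 1 \<le> F 1 + h / (1 + h) * D - s"
        using \<open>1 \<le> s\<close> by (simp add: t_def s_def algebra_simps)
      then have "P {x. real (score N x (N+1)) \<le> F 1 + t + 1} \<le> P {x. real (score N x (N+1)) \<le> F 1 + h / (1 + h) * D - s}"
        by (intro measure_pmf.finite_measure_mono) auto
      also have "\<dots> \<le> exp (- 2 * s\<^sup>2 / N)"
        by (rule prob_last_le[OF h s])
      also have "- 2 * s\<^sup>2 / N = - (\<delta>\<^sup>2 * \<theta> / 2) * (e\<^sup>2 * (real N * \<theta>))"
        using N by (simp add: s_def power2_eq_square field_simps)
      also have "\<dots> = - (\<delta>\<^sup>2 * \<theta> * c / 2) * ln (real N)"
        unfolding esq by simp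
      finally show ?thesis unfolding ln_exponent[OF N(1)] .
    qed
    have cnt: "(\<Sum>i=1..N. of_bool (V N i > 1 - K * e)) \<le> real N powr (c / 2 + \<delta> * c / 4)"
      using elim sum_strengths[of "\<lambda>y. of_bool (y > 1 - K * e)" N w "v (N+1)"] by (simp add: e_def c_def)
    have "bad N \<le> P {x. real (score N x (N+1)) \<le> F 1 + t + 1}
      + (\<Sum>i=1..N. of_bool (V N i > 1 - K * e)) * exp (- l * t + l\<^sup>2 / 2 * (1 + l) * (D / (1 - K * e)))
      + real N * exp (- 2 * (K * e * D)\<^sup>2 / N)"
      unfolding bad_def by (rule prob_not_last_ahead_le[OF N(1) h t l])
    also have "\<dots> \<le> real N powr (- (\<delta>\<^sup>2 * \<theta> * c / 2))
      + real N powr (c / 2 + \<delta> * c / 4) * real N powr (- ((1 + \<delta>) * c / 2))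
      + real N powr 1 * real N powr (- 2)"
      using b1 b2 b3 cnt by (intro add_mono mult_mono) (auto intro: sum_nonneg)
    also have "\<dots> = real N powr (- (\<delta>\<^sup>2 * \<theta> * c / 2)) + real N powr (- (\<delta> * c / 4)) + real N powr (- 1)"
      by (simp only: powr_add[symmetric]) (simp add: field_simps)
    finally show ?case .
  qed
  moreover have "(\<lambda>N. real N powr (- (\<delta>\<^sup>2 * \<theta> * c / 2)) + real N powr (- (\<delta> * c / 4)) + real N powr (- 1)) \<longlonglongrightarrow> 0 + 0 + 0"
    using d c theta by (intro tendsto_add tendsto_neg_powr filterlim_real_sequentially) auto
  moreover have "\<forall>\<^sub>F N in sequentially. 0 \<le> bad N" by (simp add: bad_def)
  ultimately have "bad \<longlonglongrightarrow> 0"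
    using tendsto_sandwich[of "\<lambda>_. 0" bad sequentially] by auto
  then have "(\<lambda>N. 1 - bad N) \<longlonglongrightarrow> 1 - 0" by (intro tendsto_intros)
  then show ?thesis unfolding qp by simp
qed

end

subsection \<open>A last player who is overtaken\<close>

context strength_profile
begin

text \<open>Full scores of members of \<open>A\<close> share the games played inside
  \<open>A\<close>. Splitting the opponents into the complement of \<open>A\<close> and the rest of
  \<open>A\<close> isolates a part that is independent across players.\<close>

definition sub_score :: "nat set \<Rightarrow> (nat \<times> nat \<Rightarrow> bool) \<Rightarrow> nat \<Rightarrow> real" where
  "sub_score B x i = (\<Sum>j\<in>B. real (Xres x i j))"

definition sub_mean :: "nat set \<Rightarrow> nat \<Rightarrow> real" where
  "sub_mean B i = (\<Sum>j\<in>B. V i / (V i + V j))"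

lemma score_split:
  assumes "i \<in> A" "A \<subseteq> {1..N}"
  shows "real (score N x i) = sub_score ({1..N} - A) x i + sub_score (A - {i}) x i"
proof -
  have eq: "{1..N} - {i} = ({1..N} - A) \<union> (A - {i})" using assms by auto
  show ?thesis
    unfolding score_def sub_score_def eq of_nat_sum using assms finite_subset[OF assms(2)]
    by (intro sum.union_disjoint) auto
qed

text \<open>The 1/2 is the fictitious game of player \<open>i\<close> against himself that is
  contained in \<open>F (V i)\<close>.\<close>

lemma sub_mean_split:
  assumes "i \<in> A" "A \<subseteq> {1..N}" "0 \<le> h" "h < 1" "1 - h \<le> V i"
  shows "F 1 - h / (1 - h) * D - 1 / 2 \<le> sub_mean ({1..N} - A) i + sub_mean (A - {i}) i"
proof -
  have i: "i \<in> {1..N}" using assms by auto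
  have eq: "{1..N} - {i} = ({1..N} - A) \<union> (A - {i})" using assms by auto
  have "F (V i) = V i / (V i + V i) + (\<Sum>j\<in>{1..N} - {i}. V i / (V i + V j))"
    unfolding mean_score_def using i by (intro sum.remove) auto
  also have "V i / (V i + V i) = 1 / 2" using V_pos'[OF i] by simp
  also have "(\<Sum>j\<in>{1..N} - {i}. V i / (V i + V j)) = sub_mean ({1..N} - A) i + sub_mean (A - {i}) i"
    unfolding sub_mean_def eq using assms finite_subset[OF assms(2)] by (intro sum.union_disjoint) auto
  finally have "F (V i) = 1 / 2 + (sub_mean ({1..N} - A) i + sub_mean (A - {i}) i)" .
  moreover have "F (1 - h) \<le> F (V i)" using assms by (intro F_mono) auto
  ultimately show ?thesis using F_down(2)[OF assms(3,4)] by linarith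
qed

text \<open>Feeds the sharp tail bound with relative error \<open>r^2 / 32\<close>. The factors with
  \<open>3 * a\<close> and \<open>6 * a\<close> are the corrections \<open>1 + l\<close> and
  \<open>1 - 2 * l\<close> at the largest tilt \<open>l = 3 * a\<close>; \<open>card A\<close> is
  the price of dropping the games inside \<open>A\<close> from the variance.\<close>

lemma prob_sub_score_ge:
  assumes i: "i \<in> A" and A: "A \<subseteq> {1..N}" and h: "0 \<le> h" "h < 1" "1 - h \<le> V i"
    and a: "0 < a" "6 * a \<le> 1" and s: "0 < s" and r: "0 < r" "r \<le> 1" and large: "8 \<le> a\<^sup>2 * s * r\<^sup>2"
    and up: "(1 + 3 * a) * (D / (1 - h)) \<le> (1 + r\<^sup>2 / 32) * s"
    and low: "(1 - r\<^sup>2 / 32) * s \<le> (1 - 6 * a) * ((1 - h) * (D - card A))"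
  shows "exp (- (a\<^sup>2 * s / 2) * (1 + 2 * r)\<^sup>2) / 2 \<le> P {x. sub_score ({1..N} - A) x i \<ge> sub_mean ({1..N} - A) i + a * s}"
proof -
  let ?B = "{1..N} - A" and ?p = "\<lambda>j. V i / (V i + V j)"
  have i1: "i \<in> {1..N}" using i A by auto
  interpret indep_bernoulli "measure_pmf (tournament N V)" ?B "\<lambda>j x. real (Xres x i j)" ?p
    using i i1 by (intro Xres_bernoulli) auto
  define Y where "Y x = sub_score ?B x i - sub_mean ?B i" for x
  define s2 where "s2 = (\<Sum>j\<in>?B. ?p j * (1 - ?p j))"
  have s2_up: "s2 \<le> D / (1 - h)"
    unfolding s2_def using i1 h by (intro var_le_D) auto
  have finA: "finite A" using finite_subset[OF A] by simp
  have s2_low: "(1 - h) * (D - card A) \<le> s2"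
  proof -
    have "D = (\<Sum>j\<in>?B. V j / (V j + 1)\<^sup>2) + (\<Sum>j\<in>A. V j / (V j + 1)\<^sup>2)"
      unfolding drift_def using A by (intro sum.subset_diff) auto
    \<comment> \<open>Each summand of the drift is at most 1, so leaving out \<open>A\<close>
      removes at most \<open>card A\<close>.\<close>
    also have "(\<Sum>j\<in>A. V j / (V j + 1)\<^sup>2) \<le> (\<Sum>j\<in>A. 1)"
    proof (intro sum_mono)
      fix j assume "j \<in> A"
      then have "V j > 0" using A V_pos' by auto
      moreover from this have "V j \<le> (V j + 1)\<^sup>2" by (simp add: power2_eq_square algebra_simps)
      ultimately show "V j / (V j + 1)\<^sup>2 \<le> 1" by (simp add: divide_le_eq)
    qed
    finally have "(1 - h) * (D - card A) \<le> (1 - h) * (\<Sum>j\<in>?B. V j / (V j + 1)\<^sup>2)"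
      using h by (intro mult_left_mono) auto
    also have "\<dots> \<le> s2"
      unfolding s2_def sum_distrib_left using h i1 V_pos' V_le by (intro sum_mono win_var_bounds) auto
    finally show ?thesis .
  qed
  have s2_nonneg: "0 \<le> s2"
    unfolding s2_def using p_bounds by (intro sum_nonneg mult_nonneg_nonneg) auto
  have Y_eq: "Y x = (\<Sum>j\<in>?B. real (Xres x i j)) - (\<Sum>j\<in>?B. ?p j)" for x
    by (simp add: Y_def sub_score_def sub_mean_def)
  have "exp (- (a\<^sup>2 * s / 2) * (1 + 2 * r)\<^sup>2) / 2 \<le> P {x \<in> space (measure_pmf (tournament N V)). Y x \<ge> a * s}"
  proof (rule prob_space.tail_ge_of_mgf[OF measure_pmf.prob_space_axioms, where h = "r\<^sup>2 / 32"])
    show "integrable (measure_pmf (tournament N V)) (\<lambda>x. exp (l * Y x))" for l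
      unfolding Y_eq by (rule mgf_eq(1))
  next
    fix l assume l: "0 \<le> l" "l \<le> 3 * a"
    have "measure_pmf.expectation (tournament N V) (\<lambda>x. exp (l * Y x)) \<le> exp (l\<^sup>2 / 2 * (1 + l) * s2)"
      using mgf_le[of l] l a unfolding Y_eq s2_def by simp
    also have "(1 + l) * s2 \<le> (1 + r\<^sup>2 / 32) * s"
      using mult_mono[of "1 + l" "1 + 3 * a" s2 "D / (1 - h)"] l a s2_up s2_nonneg up by linarith
    then have "l\<^sup>2 / 2 * ((1 + l) * s2) \<le> l\<^sup>2 / 2 * ((1 + r\<^sup>2 / 32) * s)"
      by (intro mult_left_mono) auto
    then have "exp (l\<^sup>2 / 2 * (1 + l) * s2) \<le> exp (l\<^sup>2 / 2 * (1 + r\<^sup>2 / 32) * s)"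
      by (simp only: mult.assoc exp_le_cancel_iff)
    finally show "measure_pmf.expectation (tournament N V) (\<lambda>x. exp (l * Y x)) \<le> exp (l\<^sup>2 / 2 * (1 + r\<^sup>2 / 32) * s)" .
  next
    fix l assume l: "0 \<le> l" "l \<le> 3 * a"
    have "(1 - r\<^sup>2 / 32) * s \<le> (1 - 6 * a) * s2"
      using mult_left_mono[OF s2_low, of "1 - 6 * a"] a low by linarith
    also have "\<dots> \<le> (1 - 2 * l) * s2"
      using l s2_nonneg by (intro mult_right_mono) auto
    finally have "l\<^sup>2 / 2 * ((1 - r\<^sup>2 / 32) * s) \<le> l\<^sup>2 / 2 * ((1 - 2 * l) * s2)"
      by (intro mult_left_mono) auto
    then have "exp (l\<^sup>2 / 2 * (1 - r\<^sup>2 / 32) * s) \<le> exp (l\<^sup>2 / 2 * (1 - 2 * l) * s2)"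
      by (simp only: mult.assoc exp_le_cancel_iff)
    also have "\<dots> \<le> measure_pmf.expectation (tournament N V) (\<lambda>x. exp (l * Y x))"
      using mgf_ge[of l] l a unfolding Y_eq s2_def by simp
    finally show "exp (l\<^sup>2 / 2 * (1 - r\<^sup>2 / 32) * s) \<le> measure_pmf.expectation (tournament N V) (\<lambda>x. exp (l * Y x))" .
  qed (use a s r large in auto)
  also have "{x \<in> space (measure_pmf (tournament N V)). Y x \<ge> a * s} = {x. sub_score ?B x i \<ge> sub_mean ?B i + a * s}"
    by (auto simp: Y_def)
  finally show ?thesis .
qed

text \<open>The games of distinct members of \<open>A\<close> against players outside \<open>A\<close> are disjoint sets of coordinates.\<close>

lemma prob_all_sub_score_lt:
  fixes q :: real
  assumes A: "A \<subseteq> {1..N}" "A \<noteq> {}" and q: "\<And>i. i \<in> A \<Longrightarrow> q \<le> P {x. sub_score ({1..N} - A) x i \<ge> b i}"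
  shows "P {x. \<forall>i\<in>A. sub_score ({1..N} - A) x i < b i} \<le> exp (- q * card A)"
proof -
  let ?B = "{1..N} - A"
  have finA: "finite A" using finite_subset[OF A(1)] by simp
  have ind: "prob_space.indep_vars (measure_pmf (tournament N V)) (\<lambda>_. borel) (\<lambda>i x. sub_score ?B x i) A"
  proof (rule tournament_indep[where K = "\<lambda>i. game i ` ?B"])
    show "game i ` ?B \<subseteq> pairs N" if "i \<in> A" for i
      using that subsetD[OF A(1) that] by (auto intro!: game_in_pairs)
    show "disjoint_family_on (\<lambda>i. game i ` ?B) A"
      by (auto simp: disjoint_family_on_def game_eq_iff)
    show "sub_score ?B x i = sub_score ?B y i" if "\<And>e. e \<in> game i ` ?B \<Longrightarrow> x e = y e" for i x y
      unfolding sub_score_def using that by (intro sum.cong refl arg_cong[where f = real] Xres_cong) auto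
  qed
  have "P (\<Inter>i\<in>A. (\<lambda>x. sub_score ?B x i) -` {..<b i} \<inter> space (measure_pmf (tournament N V)))
      = (\<Prod>i\<in>A. P ((\<lambda>x. sub_score ?B x i) -` {..<b i} \<inter> space (measure_pmf (tournament N V))))"
    by (rule prob_space.indep_varsD_finite[OF measure_pmf.prob_space_axioms ind A(2) finA]) auto
  moreover have "(\<Inter>i\<in>A. (\<lambda>x. sub_score ?B x i) -` {..<b i} \<inter> space (measure_pmf (tournament N V)))
      = {x. \<forall>i\<in>A. sub_score ?B x i < b i}"
    using A(2) by auto
  ultimately have "P {x. \<forall>i\<in>A. sub_score ?B x i < b i} = (\<Prod>i\<in>A. P {x. sub_score ?B x i < b i})"
    by (simp add: vimage_def)
  also have "\<dots> \<le> (\<Prod>i\<in>A. exp (- q))"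
  proof (intro prod_mono conjI)
    fix i assume i: "i \<in> A"
    have "P {x. sub_score ?B x i < b i} = 1 - P {x. \<not> sub_score ?B x i < b i}"
      by (rule prob_eq_1_minus_not)
    also have "\<dots> \<le> 1 - q" using q[OF i] by (simp add: not_less)
    also have "\<dots> \<le> exp (- q)" using exp_ge_add_one_self[of "- q"] by simp
    finally show "P {x. sub_score ?B x i < b i} \<le> exp (- q)" .
  qed simp
  also have "\<dots> = exp (- q * card A)"
    by (simp add: exp_of_nat_mult[symmetric] mult.commute)
  finally show ?thesis .
qed

text \<open>Three events can prevent overtaking: the last player scores too much, no member of
  \<open>A\<close> gains \<open>t\<close> outside \<open>A\<close>, or some member falls short by
  \<open>u\<close> inside \<open>A\<close>. The hypothesis on \<open>t\<close> also pays for the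
  lower mean of players slightly below 1 and for the self-game.\<close>

lemma prob_not_last_behind_le:
  fixes q :: real
  assumes A: "A \<subseteq> {1..N}" "A \<noteq> {}" and h: "0 \<le> h" "h < 1" "\<And>i. i \<in> A \<Longrightarrow> 1 - h \<le> V i"
    and u: "0 \<le> u" and b: "b + h / (1 - h) * D + 1 / 2 + u \<le> t"
    and q: "\<And>i. i \<in> A \<Longrightarrow> q \<le> P {x. sub_score ({1..N} - A) x i \<ge> sub_mean ({1..N} - A) i + t}"
  shows "P {x. \<not> score N x (N+1) < Max (score N x ` {1..N})}
    \<le> P {x. real (score N x (N+1)) \<ge> F 1 + b} + exp (- q * card A) + card A * exp (- 2 * u\<^sup>2 / card A)"
proof -
  let ?B = "{1..N} - A"
  let ?E1 = "{x. real (score N x (N+1)) \<ge> F 1 + b}"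
  let ?E2 = "{x. \<forall>i\<in>A. sub_score ?B x i < sub_mean ?B i + t}"
  let ?E3 = "\<lambda>i. {x. sub_score (A - {i}) x i \<le> sub_mean (A - {i}) i - u}"
  have finA: "finite A" using finite_subset[OF A(1)] by simp
  have "{x. \<not> score N x (N+1) < Max (score N x ` {1..N})} \<subseteq> (?E1 \<union> ?E2) \<union> (\<Union>i\<in>A. ?E3 i)"
  proof
    fix x assume x: "x \<in> {x. \<not> score N x (N+1) < Max (score N x ` {1..N})}"
    show "x \<in> (?E1 \<union> ?E2) \<union> (\<Union>i\<in>A. ?E3 i)"
    proof (rule ccontr)
      assume n: "x \<notin> (?E1 \<union> ?E2) \<union> (\<Union>i\<in>A. ?E3 i)"
      \<comment> \<open>Outside the three events this player has a score above
        \<open>F 1 + b\<close>, hence above that of the last player.\<close>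
      then obtain i where i: "i \<in> A" "sub_score ?B x i \<ge> sub_mean ?B i + t" by (auto simp: not_less)
      with n have "sub_score (A - {i}) x i > sub_mean (A - {i}) i - u" by auto
      with i have "real (score N x i) > sub_mean ?B i + sub_mean (A - {i}) i + t - u"
        using score_split[OF i(1) A(1), of x] by linarith
      with sub_mean_split[OF i(1) A(1) h(1,2) h(3)[OF i(1)]] b have "real (score N x i) > F 1 + b" by linarith
      moreover have "real (score N x (N+1)) < F 1 + b" using n by auto
      moreover have "score N x i \<le> Max (score N x ` {1..N})" using i A by (intro Max_ge) auto
      ultimately show False using x by simp
    qed
  qed
  then have "P {x. \<not> score N x (N+1) < Max (score N x ` {1..N})} \<le> P ((?E1 \<union> ?E2) \<union> (\<Union>i\<in>A. ?E3 i))"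
    by (intro measure_pmf.finite_measure_mono) auto
  also have "\<dots> \<le> P (?E1 \<union> ?E2) + P (\<Union>i\<in>A. ?E3 i)"
    by (intro measure_Un_le) auto
  also have "P (?E1 \<union> ?E2) \<le> P ?E1 + P ?E2"
    by (intro measure_Un_le) auto
  also have "P ?E2 \<le> exp (- q * card A)"
    by (rule prob_all_sub_score_lt[OF A q])
  also have "P (\<Union>i\<in>A. ?E3 i) \<le> (\<Sum>i\<in>A. P (?E3 i))"
    using finA by (intro measure_pmf.finite_measure_subadditive_finite) auto
  also have "\<dots> \<le> (\<Sum>i\<in>A. exp (- 2 * u\<^sup>2 / card A))"
  proof (intro sum_mono)
    fix i assume i: "i \<in> A"
    interpret indep_bernoulli "measure_pmf (tournament N V)" "A - {i}" "\<lambda>j x. real (Xres x i j)" "\<lambda>j. V i / (V i + V j)"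
      using i A by (intro Xres_bernoulli) auto
    show "P (?E3 i) \<le> exp (- 2 * u\<^sup>2 / card A)"
      using hoeffding_le[OF u, of "card A"] card_mono[OF finA, of "A - {i}"]
      by (simp add: sub_score_def sub_mean_def)
  qed
  also have "(\<Sum>i\<in>A. exp (- 2 * u\<^sup>2 / card A)) = card A * exp (- 2 * u\<^sup>2 / card A)" by simp
  finally show ?thesis by simp
qed

end

section \<open>Choice of scales and the limit for an overtaken last player\<close>

context environment
begin

text \<open>About \<open>N powr \<beta>\<close> independent attempts, each succeeding with
  probability at least \<open>N powr (- ((1 - \<delta>) * c / 2)) / 2\<close>, give an expected
  number of successes of order at least \<open>N powr (\<delta> * c / 4)\<close>, so failure of all
  is unlikely. Nonnegativity of \<alpha> gives \<open>c <= 2\<close> and hence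
  \<open>\<beta> < 1\<close>.\<close>

lemma last_player_behind:
  assumes alpha0: "0 \<le> \<alpha>" and d: "0 < \<delta>" "3 * \<delta> \<le> 1"
    and count: "\<forall>\<^sub>F N in sequentially. real N powr ((2 - \<alpha>) / 2 - \<delta> * (2 - \<alpha>) / 4) \<le> (\<Sum>k=1..N. of_bool (w k > 1 - \<delta> / 4 * \<epsilon> N))"
    and v: "\<forall>\<^sub>F N in sequentially. v (N+1) \<le> 1 + (1 - 3 * \<delta>) * \<epsilon> N"
  shows "(\<lambda>N. qprob N w (v (N+1)) (\<lambda>x. score N x (N+1) < Max (score N x ` {1..N}))) \<longlonglongrightarrow> 1"
proof -
  define c where "c = 2 - \<alpha>"
  have c: "c > 0" "c \<le> 2" using alpha alpha0 by (auto simp: c_def)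
  define \<beta> where "\<beta> = c / 2 - \<delta> * c / 4"
  have "\<delta> * c \<le> 1 * c" using d c by (intro mult_right_mono) auto
  moreover have dc: "0 < \<delta> * c" using d c by simp
  ultimately have \<beta>: "0 < \<beta>" "\<beta> < 1" using c by (auto simp: \<beta>_def)
  \<comment> \<open>Small enough that \<open>(1 + 2 * r)^2 <= 1 + \<delta>\<close>: the loss in the
    tail bound is then compensated by one factor \<open>1 - \<delta>\<close> from the square of
    \<open>a N\<close>.\<close>
  define r where "r = \<delta> / 8"
  have r: "0 < r" "r \<le> 1" using d by (auto simp: r_def)
  have r2: "0 < r\<^sup>2 / 32" "r\<^sup>2 / 32 < 1" using r power_le_one[of r 2] by auto
  define a where "a N = (1 - \<delta>) * \<epsilon> N" for N
  have a0: "a \<longlonglongrightarrow> 0"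
    unfolding a_def using tendsto_mult[OF tendsto_const[of "1 - \<delta>"] eps_tendsto_0] by simp
  define h where "h N = \<delta> / 4 * \<epsilon> N" for N
  have h0: "h \<longlonglongrightarrow> 0"
    unfolding h_def using tendsto_mult[OF tendsto_const[of "\<delta> / 4"] eps_tendsto_0] by simp
  define bad where "bad N = measure_pmf.prob (tournament N (V N)) {x. \<not> score N x (N+1) < Max (score N x ` {1..N})}" for N
  have qp: "qprob N w (v (N+1)) (\<lambda>x. score N x (N+1) < Max (score N x ` {1..N})) = 1 - bad N" for N
    unfolding bad_def qprob_def by (rule prob_eq_1_minus_not)
  let ?R = "\<lambda>N. drift N (V N) / (real N * \<theta>)"
  have "(\<lambda>N. (1 + 3 * a N) * (?R N / (1 - h N))) \<longlonglongrightarrow> (1 + 3 * 0) * (1 / (1 - 0))"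
    by (intro tendsto_intros a0 h0 drift_tendsto) auto
  then have ev1: "\<forall>\<^sub>F N in sequentially. (1 + 3 * a N) * (?R N / (1 - h N)) < 1 + r\<^sup>2 / 32"
    using r2 by (intro order_tendstoD(2)) auto
  \<comment> \<open>This is the size of \<open>A\<close> relative to
    \<open>real N * \<theta>\<close>; it vanishes because \<open>\<beta> < 1\<close>, so removing
    \<open>A\<close> does not change the leading variance.\<close>
  have p0: "(\<lambda>N. real N powr (\<beta> - 1) / \<theta>) \<longlonglongrightarrow> 0 / \<theta>"
    using \<beta> theta by (intro tendsto_divide tendsto_const tendsto_neg_powr filterlim_real_sequentially) auto
  have "(\<lambda>N. (1 - 6 * a N) * ((1 - h N) * (?R N - real N powr (\<beta> - 1) / \<theta>))) \<longlonglongrightarrow> (1 - 6 * 0) * ((1 - 0) * (1 - 0 / \<theta>))"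
    by (intro tendsto_mult tendsto_diff tendsto_const a0 h0 drift_tendsto p0)
  then have ev2: "\<forall>\<^sub>F N in sequentially. 1 - r\<^sup>2 / 32 < (1 - 6 * a N) * ((1 - h N) * (?R N - real N powr (\<beta> - 1) / \<theta>))"
    using r2 by (intro order_tendstoD(1)) auto
  have "(\<lambda>N. \<delta> / 4 * ?R N / (1 - h N)) \<longlonglongrightarrow> \<delta> / 4 * 1 / (1 - 0)"
    by (intro tendsto_intros h0 drift_tendsto) auto
  then have ev3: "\<forall>\<^sub>F N in sequentially. \<delta> / 4 * ?R N / (1 - h N) < \<delta> / 2"
    using d by (intro order_tendstoD(2)) auto
  have "(\<lambda>N. (1 - 3 * \<delta>) * ?R N) \<longlonglongrightarrow> (1 - 3 * \<delta>) * 1"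
    by (intro tendsto_intros drift_tendsto)
  then have ev4: "\<forall>\<^sub>F N in sequentially. (1 - 3 * \<delta>) * ?R N < 1 - 5 / 2 * \<delta>"
    using d by (intro order_tendstoD(2)) auto
  have ev5: "\<forall>\<^sub>F N in sequentially. h N < 1"
    by (intro order_tendstoD(2)[OF h0]) simp
  have ev6: "\<forall>\<^sub>F N in sequentially. a N < 1 / 6"
    by (intro order_tendstoD(2)[OF a0]) simp
  have ev7: "\<forall>\<^sub>F N in sequentially. 2 / (\<delta> * \<theta>) \<le> \<epsilon> N * real N"
    using eps_N_at_top unfolding filterlim_at_top by blast
  have powr_top: "filterlim (\<lambda>N. real N powr k) at_top sequentially" if "k > 0" for k :: real
    using that by real_asymp
  have "filterlim (\<lambda>N. real N powr (1 - \<beta>)) at_top sequentially"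
    using \<beta> by (intro powr_top) auto
  \<comment> \<open>Makes the Hoeffding exponent for games inside \<open>A\<close> at least
    \<open>2 * ln (real N)\<close>.\<close>
  then have ev8: "\<forall>\<^sub>F N in sequentially. 16 / (\<delta>\<^sup>2 * \<theta> * c) \<le> real N powr (1 - \<beta>)"
    unfolding filterlim_at_top by blast
  have "filterlim (\<lambda>N. real N powr \<beta>) at_top sequentially"
    using \<beta> by (intro powr_top) auto
  then have ev9: "\<forall>\<^sub>F N in sequentially. 2 \<le> real N powr \<beta>"
    unfolding filterlim_at_top by blast
  have "filterlim (\<lambda>N. ln (real N)) at_top sequentially"
    by (intro filterlim_compose[OF ln_at_top] filterlim_real_sequentially)
  \<comment> \<open>Supplies the largeness hypothesis \<open>8 <= (a N)^2 * m * r^2\<close> of the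
    tail bound.\<close>
  then have ev10: "\<forall>\<^sub>F N in sequentially. 8 / ((1 - \<delta>)\<^sup>2 * c * r\<^sup>2) \<le> ln (real N)"
    unfolding filterlim_at_top by blast
  have "\<forall>\<^sub>F N in sequentially. bad N \<le> real N powr (- (\<delta>\<^sup>2 * \<theta> * c / 2)) + exp (- (real N powr (\<delta> * c / 4) / 4)) + real N powr (- 1)"
    using ev1 ev2 ev3 ev4 ev5 ev6 ev7 ev8 ev9 ev10 count v eventually_ge_at_top[of 2]
  proof eventually_elim
    case (elim N)
    note ev = elim
    have N: "N \<ge> 1" "N \<ge> 2" "real N > 0" using ev(13) by auto
    interpret strength_profile N "V N" by (rule strength_profile_V[OF N(1)])
    define e where "e = \<epsilon> N"
    have e: "e > 0" using eps_pos[OF N(2)] by (simp add: e_def)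
    have esq: "e\<^sup>2 * (real N * \<theta>) = c * ln (real N)"
      using eps_sq[OF N(1)] by (simp add: e_def c_def)
    have aN: "a N = (1 - \<delta>) * e" and hN: "h N = \<delta> / 4 * e" by (simp_all add: a_def h_def e_def)
    define m where "m = real N * \<theta>"
    have m: "m > 0" using N theta by (simp add: m_def)
    have em: "e * m > 0" using e m by simp
    have lnN: "ln (real N) > 0" using N by simp
    have h: "0 \<le> h N" "h N < 1" using e d ev(5) by (auto simp: hN)
    have a: "0 < a N" "6 * a N \<le> 1" using e d ev(6) by (auto simp: aN)
    \<comment> \<open>Rounding down loses at most a factor 2, since
      \<open>real N powr \<beta>\<close> is at least 2.\<close>
    define n where "n = nat \<lfloor>real N powr \<beta>\<rfloor>"
    have n: "real n \<le> real N powr \<beta>" "real N powr \<beta> / 2 \<le> real n"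
      using ev(9) unfolding n_def by linarith+
    have n0: "n > 0" using n ev(9) by linarith
    define T where "T = {i \<in> {1..N}. V N i > 1 - h N}"
    have "(\<Sum>k=1..N. of_bool (w k > 1 - h N)) = (\<Sum>i=1..N. of_bool (V N i > 1 - h N) :: real)"
      using sum_strengths[of "\<lambda>y. of_bool (y > 1 - h N)" N w "v (N+1)"] by simp
    also have "\<dots> = real (card T)"
      by (simp add: T_def of_bool_def sum.If_cases Int_def)
    finally have "real N powr \<beta> \<le> real (card T)"
      using ev(11) by (simp add: \<beta>_def c_def h_def)
    then have "n \<le> card T" using n by linarith
    \<comment> \<open>All of \<open>T\<close> might be too large, as its size is only bounded below;
      the subset keeps the games inside \<open>A\<close> negligible.\<close>
    then obtain A where A: "A \<subseteq> T" "card A = n" "finite A" by (rule obtain_subset_with_card_n)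
    have A1: "A \<subseteq> {1..N}" "A \<noteq> {}" using A n0 by (auto simp: T_def)
    have VA: "1 - h N \<le> V N i" if "i \<in> A" for i using A(1) that by (auto simp: T_def)
    \<comment> \<open>In units of \<open>e * m\<close>, \<open>t\<close> is
      \<open>1 - \<delta>\<close> and \<open>b\<close> is \<open>1 - 2 * \<delta>\<close>. The gap
      \<delta> is spent as \<open>\<delta> / 2\<close> on the lower means in \<open>A\<close>,
      \<open>\<delta> / 4\<close> on \<open>u\<close> and \<open>\<delta> / 4\<close> on the
      constant 1/2.\<close>
    define t where "t = a N * m"
    define b where "b = (1 - 2 * \<delta>) * (e * m)"
    define u where "u = \<delta> / 4 * (e * m)"
    define q where "q = exp (- ((a N)\<^sup>2 * m / 2) * (1 + 2 * r)\<^sup>2) / 2"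
    have asq: "(a N)\<^sup>2 * m = (1 - \<delta>)\<^sup>2 * (c * ln (real N))"
      using esq by (simp add: aN m_def power_mult_distrib mult.assoc)
    have u: "0 \<le> u" using d em by (simp add: u_def)
    have half: "1 / 2 \<le> \<delta> / 4 * (e * m)"
      using ev(7) d theta by (simp add: e_def m_def field_simps)
    have bt: "b + h N / (1 - h N) * D + 1 / 2 + u \<le> t"
    proof -
      have "h N / (1 - h N) * D = \<delta> / 4 * (D / m) / (1 - h N) * (e * m)"
        using m by (simp add: hN)
      also have "\<dots> \<le> \<delta> / 2 * (e * m)"
        using ev(3) em by (intro mult_right_mono) (auto simp: m_def)
      finally have le: "h N / (1 - h N) * D \<le> \<delta> / 2 * (e * m)" .
      have "b + y + 1 / 2 + u \<le> t" if "y \<le> \<delta> / 2 * (e * m)" for y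
        using that half by (simp add: b_def t_def u_def aN algebra_simps)
      then show ?thesis using le .
    qed
    have q: "q \<le> P {x. sub_score ({1..N} - A) x i \<ge> sub_mean ({1..N} - A) i + t}" if i: "i \<in> A" for i
      unfolding q_def t_def
    proof (rule prob_sub_score_ge[OF i A1(1) h VA[OF i] a m r])
      have "8 \<le> ln (real N) * ((1 - \<delta>)\<^sup>2 * c * r\<^sup>2)"
        using ev(10) d c r by (simp add: pos_divide_le_eq)
      then show "8 \<le> (a N)\<^sup>2 * m * r\<^sup>2"
        unfolding asq by (simp add: mult_ac)
      have "(1 + 3 * a N) * (D / (1 - h N)) = (1 + 3 * a N) * ((D / m) / (1 - h N)) * m"
        using m by simp
      also have "\<dots> \<le> (1 + r\<^sup>2 / 32) * m"
        using ev(1) m by (intro mult_right_mono) (auto simp: m_def)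
      finally show "(1 + 3 * a N) * (D / (1 - h N)) \<le> (1 + r\<^sup>2 / 32) * m" .
      have "(1 - r\<^sup>2 / 32) * m \<le> (1 - 6 * a N) * ((1 - h N) * (D / m - real N powr (\<beta> - 1) / \<theta>)) * m"
        using ev(2) m by (intro mult_right_mono) (auto simp: m_def)
      also have "\<dots> = (1 - 6 * a N) * ((1 - h N) * (D - real N powr (\<beta> - 1) / \<theta> * m))"
      proof -
        have "x * (y * (D / m - k)) * m = x * (y * (D - k * m))" for x y k
          using m by (simp add: field_simps)
        then show ?thesis .
      qed
      also have "real N powr (\<beta> - 1) / \<theta> * m = real N powr \<beta>"
        using N theta by (simp add: m_def powr_diff)
      also have "(1 - 6 * a N) * ((1 - h N) * (D - real N powr \<beta>)) \<le> (1 - 6 * a N) * ((1 - h N) * (D - real (card A)))"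
        using a h n A(2) by (intro mult_left_mono) auto
      finally show "(1 - r\<^sup>2 / 32) * m \<le> (1 - 6 * a N) * ((1 - h N) * (D - real (card A)))" .
    qed
    have b1: "P {x. real (score N x (N+1)) \<ge> F 1 + b} \<le> real N powr (- (\<delta>\<^sup>2 * \<theta> * c / 2))"
    proof -
      \<comment> \<open>The last player's mean is at most \<open>1 - 5 / 2 * \<delta>\<close> units
        above \<open>F 1\<close>, which leaves half a \<delta> below \<open>b\<close> for the
        fluctuation.\<close>
      define g where "g = (1 - 3 * \<delta>) * e"
      define s where "s = \<delta> / 2 * (e * m)"
      have g: "0 \<le> g" "V N (N+1) \<le> 1 + g" using e d ev(12) unfolding V_last by (auto simp: g_def e_def)
      have s: "0 \<le> s" using d em by (simp add: s_def)
      have "g * D = (1 - 3 * \<delta>) * (D / m) * (e * m)" using m by (simp add: g_def)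
      also have "\<dots> \<le> (1 - 5 / 2 * \<delta>) * (e * m)"
        using ev(4) em by (intro mult_right_mono) (auto simp: m_def)
      finally have "F 1 + g * D + s \<le> F 1 + b" by (simp add: b_def s_def algebra_simps)
      then have "P {x. real (score N x (N+1)) \<ge> F 1 + b} \<le> P {x. real (score N x (N+1)) \<ge> F 1 + g * D + s}"
        by (intro measure_pmf.finite_measure_mono) auto
      also have "\<dots> \<le> exp (- 2 * s\<^sup>2 / N)" by (rule prob_last_ge[OF g s])
      also have "- 2 * s\<^sup>2 / N = - (\<delta>\<^sup>2 * \<theta> / 2) * (e\<^sup>2 * (real N * \<theta>))"
        using N by (simp add: s_def m_def power2_eq_square field_simps)
      also have "\<dots> = - (\<delta>\<^sup>2 * \<theta> * c / 2) * ln (real N)"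
        unfolding esq by simp
      finally show ?thesis unfolding ln_exponent[OF N(1)] .
    qed
    have b2: "exp (- q * card A) \<le> exp (- (real N powr (\<delta> * c / 4) / 4))"
    proof -
      have "(1 - \<delta>) * (1 + 2 * r)\<^sup>2 \<le> 1"
      proof -
        have "\<delta> * \<delta> \<le> \<delta> * 1" using d by (intro mult_left_mono) auto
        then have "(1 + 2 * r)\<^sup>2 \<le> 1 + \<delta>" using d by (simp add: r_def power2_eq_square field_simps)
        then have "(1 - \<delta>) * (1 + 2 * r)\<^sup>2 \<le> (1 - \<delta>) * (1 + \<delta>)" using d by (intro mult_left_mono) auto
        also have "\<dots> \<le> 1" by (simp add: algebra_simps)
        finally show ?thesis .
      qed
      then have "(1 - \<delta>) * c / 2 * ln (real N) * ((1 - \<delta>) * (1 + 2 * r)\<^sup>2) \<le> (1 - \<delta>) * c / 2 * ln (real N) * 1"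
        using d c lnN by (intro mult_left_mono) auto
      moreover have "(a N)\<^sup>2 * m / 2 * (1 + 2 * r)\<^sup>2 = (1 - \<delta>) * c / 2 * ln (real N) * ((1 - \<delta>) * (1 + 2 * r)\<^sup>2)"
        unfolding asq by (simp add: power2_eq_square)
      ultimately have "- ((1 - \<delta>) * c / 2) * ln (real N) \<le> - ((a N)\<^sup>2 * m / 2) * (1 + 2 * r)\<^sup>2"
        by linarith
      then have "exp (- ((1 - \<delta>) * c / 2) * ln (real N)) \<le> exp (- ((a N)\<^sup>2 * m / 2) * (1 + 2 * r)\<^sup>2)"
        by (rule exp_le_cancel_iff[THEN iffD2])
      then have "real N powr (- ((1 - \<delta>) * c / 2)) / 2 \<le> q"
        unfolding q_def ln_exponent[OF N(1)] by linarith
      then have "real N powr (- ((1 - \<delta>) * c / 2)) / 2 * (real N powr \<beta> / 2) \<le> q * real (card A)"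
        using n A(2) by (intro mult_mono) (auto simp: q_def)
      moreover have "real N powr (- ((1 - \<delta>) * c / 2)) * real N powr \<beta> = real N powr (\<delta> * c / 4)"
        by (simp add: \<beta>_def powr_add[symmetric]) (simp add: field_simps)
      ultimately show ?thesis by simp
    qed
    have b3: "card A * exp (- 2 * u\<^sup>2 / card A) \<le> real N powr (- 1)"
    proof -
      have "2 * u\<^sup>2 / (real N powr \<beta>) \<le> 2 * u\<^sup>2 / real n"
        using n n0 N by (intro divide_left_mono mult_pos_pos) auto
      moreover have "2 * u\<^sup>2 / (real N powr \<beta>) = \<delta>\<^sup>2 * \<theta> * c / 8 * real N powr (1 - \<beta>) * ln (real N)"
      proof -
        have u2: "2 * u\<^sup>2 = \<delta>\<^sup>2 * \<theta> / 8 * real N * (e\<^sup>2 * (real N * \<theta>))"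
          by (simp add: u_def m_def power2_eq_square)
        have "2 * u\<^sup>2 / (real N powr \<beta>) = \<delta>\<^sup>2 * \<theta> / 8 * (real N / real N powr \<beta>) * (c * ln (real N))"
          unfolding u2 esq by simp
        also have "real N / real N powr \<beta> = real N powr (1 - \<beta>)"
          using N by (simp add: powr_diff)
        finally show ?thesis by simp
      qed
      moreover have "2 \<le> \<delta>\<^sup>2 * \<theta> * c / 8 * real N powr (1 - \<beta>)"
        using ev(8) d theta c by (simp add: field_simps)
      then have "2 * ln (real N) \<le> \<delta>\<^sup>2 * \<theta> * c / 8 * real N powr (1 - \<beta>) * ln (real N)"
        using lnN by (intro mult_right_mono) auto
      ultimately have "- 2 * u\<^sup>2 / card A \<le> - 2 * ln (real N)"
        using A(2) by simp
      then have "exp (- 2 * u\<^sup>2 / card A) \<le> exp (- 2 * ln (real N))"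
        by (rule exp_le_cancel_iff[THEN iffD2])
      moreover have "card A \<le> N" using card_mono[OF _ A1(1)] by simp
      ultimately have "card A * exp (- 2 * u\<^sup>2 / card A) \<le> real N powr 1 * real N powr (- 2)"
        unfolding ln_exponent[OF N(1)] using N by (intro mult_mono) auto
      also have "\<dots> = real N powr (- 1)" by (simp only: powr_add[symmetric]) simp
      finally show ?thesis .
    qed
    have "bad N \<le> P {x. real (score N x (N+1)) \<ge> F 1 + b} + exp (- q * card A) + card A * exp (- 2 * u\<^sup>2 / card A)"
      unfolding bad_def by (rule prob_not_last_behind_le[OF A1 h VA u bt q])
    then show ?case using b1 b2 b3 by linarith
  qed
  moreover have "(\<lambda>N. real N powr (- (\<delta>\<^sup>2 * \<theta> * c / 2)) + exp (- (real N powr (\<delta> * c / 4) / 4)) + real N powr (- 1)) \<longlonglongrightarrow> 0 + 0 + 0"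
  proof (intro tendsto_add tendsto_neg_powr filterlim_real_sequentially)
    have "((\<lambda>N. exp (- (real N powr k / 4))) \<longlongrightarrow> 0) sequentially" if "k > 0" for k
      using that by real_asymp
    then show "(\<lambda>N. exp (- (real N powr (\<delta> * c / 4) / 4))) \<longlonglongrightarrow> 0"
      using dc by simp
  qed (use d c theta in auto)
  moreover have "\<forall>\<^sub>F N in sequentially. 0 \<le> bad N" by (simp add: bad_def)
  ultimately have "bad \<longlonglongrightarrow> 0"
    using tendsto_sandwich[of "\<lambda>_. 0" bad sequentially] by auto
  then have "(\<lambda>N. 1 - bad N) \<longlonglongrightarrow> 1 - 0" by (intro tendsto_intros)
  then show ?thesis unfolding qp by simp
qed

end

section \<open>From score gaps to winning, and the almost sure statement\<close>

lemma last_wins_if_ahead: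
  assumes "real (score N x (N+1)) > 1 + real (Max (score N x ` {1..N}))"
  shows "last_wins N x"
  unfolding last_wins_def
proof
  fix i assume i: "i \<in> {1..N}"
  have "score N x i \<le> Max (score N x ` {1..N})" using i by (intro Max_ge) auto
  \<comment> \<open>A lead of more than 1 covers the one point that player \<open>i\<close> may gain
    in the game against player \<open>N+1\<close>, which \<open>score N x i\<close> leaves
    out.\<close>
  then show "score N x (N+1) \<ge> score N x i + Xres x i (N+1)"
    using assms Xres_01[of x i "N+1"] by linarith
qed

text \<open>The game left out of \<open>score N x i\<close> can only add to the total of the leading
  player, so a deficit against the partial scores already excludes a win.\<close>

lemma not_last_wins_if_behind:
  assumes "N \<ge> 1" "score N x (N+1) < Max (score N x ` {1..N})"
  shows "\<not> last_wins N x"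
proof -
  have "Max (score N x ` {1..N}) \<in> score N x ` {1..N}" using assms(1) by (intro Max_in) auto
  then obtain i where "i \<in> {1..N}" "Max (score N x ` {1..N}) = score N x i" by auto
  then show ?thesis using assms(2) by (force simp: last_wins_def)
qed

lemma qprob_mono: "(\<And>x. E x \<Longrightarrow> E' x) \<Longrightarrow> qprob N w u E \<le> qprob N w u E'"
  unfolding qprob_def by (intro measure_pmf.finite_measure_mono) auto

lemma AE_distr_transfer:
  assumes "X \<in> borel_measurable M" "Y \<in> borel_measurable M" "distr M borel X = distr M borel Y"
    and "Measurable.pred borel P" "AE \<omega> in M. P (Y \<omega>)"
  shows "AE \<omega> in M. P (X \<omega>)"
proof -
  have "AE x in distr M borel X. P x"
    unfolding assms(3) using assms by (subst AE_distr_iff) auto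
  then show ?thesis using assms by (subst (asm) AE_distr_iff) auto
qed

text \<open>One null set serves all \<open>N\<close>, since the samples for different
  \<open>N\<close> are initial segments of one sequence. The probabilities are compared for
  \<open>N >= 1\<close>, where the maximum is over a nonempty set.\<close>

theorem theorem3:
  fixes M :: "'a measure" and U :: "'a \<Rightarrow> real" and Us :: "nat \<Rightarrow> 'a \<Rightarrow> real"
    and v :: "nat \<Rightarrow> real" and \<alpha> :: real
  defines "Q \<equiv> (\<lambda>x. measure M {\<omega>\<in>space M. U \<omega> > x})"
    and "theta \<equiv> integral\<^sup>L M (\<lambda>\<omega>. U \<omega> / (U \<omega> + 1)^2)"
  defines "\<epsilon> \<equiv> (\<lambda>N::nat. sqrt ((2 - \<alpha>) / theta * (ln (real N) / real N)))"
  assumes "prob_space M"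
    and "U \<in> borel_measurable M"
    and "AE \<omega> in M. U \<omega> > 0"
    and "prob_space.indep_vars M (\<lambda>_. borel) Us {1..}"
    and "\<forall>k\<ge>1. distr M borel (Us k) = distr M borel U"
    and "1 \<in> dist_support (distr M borel U)"
    and "\<forall>x\<in>dist_support (distr M borel U). x \<le> 1"
    and "0 \<le> \<alpha>" and "\<alpha> < 2"
    and "(\<lambda>u. ln (Q (1 - u)) - \<alpha> * ln u) \<in> o[at_right 0](\<lambda>u. ln u)"
    and "\<forall>N\<ge>1. v (N+1) > 0"
  shows
    "(liminf (\<lambda>N. ereal ((v (N+1) - 1) / \<epsilon> N)) > 1 \<longrightarrow>
       (AE \<omega> in M.
          (\<forall>N\<ge>1. qprob N (\<lambda>k. Us k \<omega>) (v (N+1)) (last_wins N)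
                  \<ge> qprob N (\<lambda>k. Us k \<omega>) (v (N+1))
                      (\<lambda>x. real (score N x (N+1)) > 1 + real (Max ((score N x) ` {1..N}))))
        \<and> (\<lambda>N. qprob N (\<lambda>k. Us k \<omega>) (v (N+1))
                      (\<lambda>x. real (score N x (N+1)) > 1 + real (Max ((score N x) ` {1..N}))))
            \<longlonglongrightarrow> 1))
   \<and>
     (limsup (\<lambda>N. ereal ((v (N+1) - 1) / \<epsilon> N)) < 1 \<longrightarrow>
       (AE \<omega> in M.
          (\<forall>N\<ge>1. qprob N (\<lambda>k. Us k \<omega>) (v (N+1)) (\<lambda>x. \<not> last_wins N x)
                  \<ge> qprob N (\<lambda>k. Us k \<omega>) (v (N+1))
                      (\<lambda>x. score N x (N+1) < Max ((score N x) ` {1..N})))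
        \<and> (\<lambda>N. qprob N (\<lambda>k. Us k \<omega>) (v (N+1))
                      (\<lambda>x. score N x (N+1) < Max ((score N x) ` {1..N})))
            \<longlonglongrightarrow> 1))"
proof -
  interpret prob_space M by fact
  note U [measurable] = \<open>U \<in> borel_measurable M\<close>
  note indep = \<open>indep_vars (\<lambda>_. borel) Us {1..}\<close>
  have distr: "distr M borel (Us k) = distr M borel U" if "k \<ge> 1" for k
    using \<open>\<forall>k\<ge>1. distr M borel (Us k) = distr M borel U\<close> that by blast
  have Us [measurable]: "Us k \<in> borel_measurable M" if "k \<ge> 1" for k
    using indep that by (auto simp: indep_vars_def)
  define g :: "real \<Rightarrow> real" where "g x = x / (x + 1)\<^sup>2" for x
  have g [measurable]: "g \<in> borel_measurable borel" unfolding g_def by measurable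
  have theta_eq: "theta = expectation (\<lambda>\<omega>. g (U \<omega>))" by (simp add: theta_def g_def)
  have "prob_space (distr M borel U)" by (rule prob_space_distr) (rule U)
  then have "AE x in distr M borel U. x \<le> 1"
    by (rule AE_le_of_dist_support) (use \<open>\<forall>x\<in>dist_support (distr M borel U). x \<le> 1\<close> in auto)
  then have "AE \<omega> in M. U \<omega> \<le> 1" by (subst (asm) AE_distr_iff) auto
  with \<open>AE \<omega> in M. U \<omega> > 0\<close> have U01: "AE \<omega> in M. 0 < U \<omega> \<and> U \<omega> \<le> 1" by auto
  have "AE \<omega> in M. 0 < Us k \<omega> \<and> Us k \<omega> \<le> 1" if "k \<ge> 1" for k
    by (rule AE_distr_transfer[OF Us[OF that] U distr[OF that] _ U01]) measurable
  then have "AE \<omega> in M. k \<ge> 1 \<longrightarrow> 0 < Us k \<omega> \<and> Us k \<omega> \<le> 1" for k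
    by (cases "k \<ge> 1") auto
  then have w01: "AE \<omega> in M. \<forall>k. k \<ge> 1 \<longrightarrow> 0 < Us k \<omega> \<and> Us k \<omega> \<le> 1"
    unfolding AE_all_countable by blast
  have gU: "AE \<omega> in M. g (U \<omega>) \<in> {0..1} \<and> g (U \<omega>) > 0"
    using U01
  proof eventually_elim
    case (elim \<omega>)
    then have "U \<omega> \<le> (U \<omega> + 1)\<^sup>2" by (simp add: power2_eq_square algebra_simps)
    then show ?case using elim by (auto simp: g_def divide_le_eq)
  qed
  have gU_int: "integrable M (\<lambda>\<omega>. g (U \<omega>))"
    by (rule integrable_const_bound[where B = 1]) (use gU in auto)
  have theta: "theta > 0"
  proof -
    have "theta \<ge> 0" unfolding theta_eq using gU by (intro integral_nonneg_AE) auto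
    moreover have "theta \<noteq> 0"
    proof
      assume "theta = 0"
      then have "AE \<omega> in M. g (U \<omega>) = 0"
        unfolding theta_eq using gU by (subst (asm) integral_nonneg_eq_0_iff_AE[OF gU_int]) auto
      with gU have "AE \<omega> in M. False" by eventually_elim auto
      then show False by (simp add: AE_False)
    qed
    ultimately show ?thesis by simp
  qed
  have "AE \<omega> in M. (\<lambda>N. (\<Sum>k=1..N. g (Us k \<omega>)) / real N) \<longlonglongrightarrow> expectation (\<lambda>\<omega>. g (U \<omega>))"
  proof (rule strong_law_bounded)
    show "indep_vars (\<lambda>_. borel) (\<lambda>k \<omega>. g (Us k \<omega>)) {1..}"
      by (rule indep_vars_compose2[OF indep]) simp
    show "distr M borel (\<lambda>\<omega>. g (Us k \<omega>)) = distr M borel (\<lambda>\<omega>. g (U \<omega>))" if "k \<ge> 1" for k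
    proof -
      have "distr M borel (g \<circ> Us k) = distr M borel (g \<circ> U)"
        using distr_distr[OF g Us[OF that]] distr_distr[OF g U] distr[OF that] by simp
      then show ?thesis by (simp add: comp_def)
    qed
  qed (use gU in auto)
  then have env: "AE \<omega> in M. environment (\<lambda>k. Us k \<omega>) theta \<alpha> \<epsilon> v"
    using w01
  proof eventually_elim
    case (elim \<omega>)
    show ?case
      by unfold_locales
        (use elim theta \<open>\<alpha> < 2\<close> \<open>\<forall>N\<ge>1. v (N+1) > 0\<close> in \<open>auto simp: \<epsilon>_def theta_eq g_def\<close>)
  qed
  \<comment> \<open>At \<open>N = 0\<close> and \<open>N = 1\<close> the logarithm is 0 and so is
    \<open>\<epsilon> N\<close>; later divisions therefore start at 2.\<close>
  have eps_pos: "\<epsilon> N > 0" if "N \<ge> 2" for N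
    using that theta \<open>\<alpha> < 2\<close> by (simp add: \<epsilon>_def)
  \<comment> \<open>Since 1 lies in the support, every ball around it has positive mass, which makes
    the logarithm of the tail meaningful.\<close>
  have Q_pos: "Q (1 - u) > 0" if "u > 0" for u
  proof -
    have "0 < measure (distr M borel U) (ball 1 u)"
      using \<open>1 \<in> dist_support (distr M borel U)\<close> that by (auto simp: dist_support_def)
    also have "\<dots> = prob (U -` ball 1 u \<inter> space M)" by (rule measure_distr) auto
    also have "\<dots> \<le> Q (1 - u)"
      unfolding Q_def by (intro finite_measure_mono) (auto simp: dist_real_def)
    finally show ?thesis .
  qed
  \<comment> \<open>A constant multiple of \<epsilon> does not change the exponent. Hence a large
    \<open>K\<close> in the first case and the small \<open>\<delta> / 4\<close> in the second lead
    to counts with the same leading power.\<close>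
  have tail: "(\<lambda>N. ln (Q (1 - K * \<epsilon> N)) / ln (real N)) \<longlonglongrightarrow> - \<alpha> / 2"
    "\<forall>\<^sub>F N in sequentially. Q (1 - K * \<epsilon> N) > 0" if K: "K > 0" for K
  proof -
    have pos: "\<forall>\<^sub>F N in sequentially. 0 < K * \<epsilon> N"
      using eventually_ge_at_top[of 2] by eventually_elim (use K eps_pos in auto)
    then show "\<forall>\<^sub>F N in sequentially. Q (1 - K * \<epsilon> N) > 0"
      by eventually_elim (rule Q_pos)
    have asymp: "(\<lambda>N. K * sqrt (c * (ln (real N) / real N))) \<longlonglongrightarrow> 0"
      "(\<lambda>N. ln (K * sqrt (c * (ln (real N) / real N))) / ln (real N)) \<longlonglongrightarrow> - 1 / 2" if "c > 0" for c
      using that K by real_asymp+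
    have c: "(2 - \<alpha>) / theta > 0" using theta \<open>\<alpha> < 2\<close> by simp
    show "(\<lambda>N. ln (Q (1 - K * \<epsilon> N)) / ln (real N)) \<longlonglongrightarrow> - \<alpha> / 2"
    proof (rule tail_exponent)
      show "filterlim (\<lambda>N. K * \<epsilon> N) (at_right 0) sequentially"
        using asymp(1)[OF c] pos unfolding \<epsilon>_def by (rule tendsto_imp_filterlim_at_right)
      show "(\<lambda>N. ln (K * \<epsilon> N) / ln (real N)) \<longlonglongrightarrow> - 1 / 2"
        using asymp(2)[OF c] unfolding \<epsilon>_def .
    qed fact
  qed
  have half: "1 + - \<alpha> / 2 = (2 - \<alpha>) / 2" by (simp add: field_simps)
  have count_le: "AE \<omega> in M. \<forall>\<^sub>F N in sequentially.
      (\<Sum>k=1..N. of_bool (Us k \<omega> > 1 - K * \<epsilon> N)) \<le> real N powr ((2 - \<alpha>) / 2 + \<kappa>)" if "K > 0" "\<kappa> > 0" for K \<kappa>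
  proof (rule AE_count_le[OF indep distr U refl])
    show "\<forall>\<^sub>F N in sequentially. 2 * (real N * prob {\<omega> \<in> space M. U \<omega> > 1 - K * \<epsilon> N}) \<le> real N powr ((2 - \<alpha>) / 2 + \<kappa>)"
      using eventually_powr_bounds(1)[OF tail[OF that(1)] that(2)] unfolding half Q_def .
    show "summable (\<lambda>N. exp (- (real N powr ((2 - \<alpha>) / 2 + \<kappa>)) / 16))"
      using that \<open>\<alpha> < 2\<close> by (intro summable_exp_neg_powr add_pos_pos) auto
  qed
  have count_ge: "AE \<omega> in M. \<forall>\<^sub>F N in sequentially.
      real N powr ((2 - \<alpha>) / 2 - \<kappa>) \<le> (\<Sum>k=1..N. of_bool (Us k \<omega> > 1 - K * \<epsilon> N))"
    if "K > 0" "\<kappa> > 0" "\<kappa> < (2 - \<alpha>) / 2" for K \<kappa>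
  proof (rule AE_count_ge[OF indep distr U refl])
    show "\<forall>\<^sub>F N in sequentially. 2 * real N powr ((2 - \<alpha>) / 2 - \<kappa>) \<le> real N * prob {\<omega> \<in> space M. U \<omega> > 1 - K * \<epsilon> N}"
      using eventually_powr_bounds(2)[OF tail[OF that(1)] that(2)] unfolding half Q_def .
    show "summable (\<lambda>N. exp (- (real N powr ((2 - \<alpha>) / 2 - \<kappa>)) / 16))"
      using that by (intro summable_exp_neg_powr) simp
  qed simp_all
  show ?thesis
  proof (intro conjI impI)
    assume "liminf (\<lambda>N. ereal ((v (N+1) - 1) / \<epsilon> N)) > 1"
    \<comment> \<open>The lower limit may be infinite, so a real number strictly between is chosen;
      it determines \<delta>.\<close>
    then obtain y where y: "1 < ereal y" "ereal y < liminf (\<lambda>N. ereal ((v (N+1) - 1) / \<epsilon> N))"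
      using ereal_dense2 by blast
    define \<delta> where "\<delta> = (y - 1) / 3"
    have d: "\<delta> > 0" "y = 1 + 3 * \<delta>" using y(1) by (auto simp: \<delta>_def field_simps)
    have v: "\<forall>\<^sub>F N in sequentially. 1 + (1 + 3 * \<delta>) * \<epsilon> N \<le> v (N+1)"
      using less_LiminfD[OF y(2)] eventually_ge_at_top[of 2]
    proof eventually_elim
      case (elim N)
      then show ?case using eps_pos[of N] d by (simp add: pos_less_divide_eq)
    qed
    have dc: "0 < \<delta> * (2 - \<alpha>) / 4" using d \<open>\<alpha> < 2\<close> by simp
    \<comment> \<open>The value for which \<open>K^2 * theta * (2 - \<alpha>)\<close> equals
      4.\<close>
    define K where "K = sqrt (4 / (theta * (2 - \<alpha>)))"
    have K: "K > 0" "4 \<le> K\<^sup>2 * theta * (2 - \<alpha>)"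
      using theta \<open>\<alpha> < 2\<close> by (auto simp: K_def field_simps)
    have "AE \<omega> in M. (\<lambda>N. qprob N (\<lambda>k. Us k \<omega>) (v (N+1))
        (\<lambda>x. real (score N x (N+1)) > 1 + real (Max ((score N x) ` {1..N})))) \<longlonglongrightarrow> 1"
      using env count_le[OF K(1) dc]
    proof eventually_elim
      case (elim \<omega>)
      then show ?case by (intro environment.last_player_ahead[OF _ d(1) K _ v])
    qed
    then show "AE \<omega> in M.
          (\<forall>N\<ge>1. qprob N (\<lambda>k. Us k \<omega>) (v (N+1)) (last_wins N)
                  \<ge> qprob N (\<lambda>k. Us k \<omega>) (v (N+1))
                      (\<lambda>x. real (score N x (N+1)) > 1 + real (Max ((score N x) ` {1..N}))))
        \<and> (\<lambda>N. qprob N (\<lambda>k. Us k \<omega>) (v (N+1))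
                      (\<lambda>x. real (score N x (N+1)) > 1 + real (Max ((score N x) ` {1..N}))))
            \<longlonglongrightarrow> 1"
    proof eventually_elim
      case (elim \<omega>)
      then show ?case by (intro conjI allI impI qprob_mono last_wins_if_ahead)
    qed
  next
    assume "limsup (\<lambda>N. ereal ((v (N+1) - 1) / \<epsilon> N)) < 1"
    then obtain z where z: "limsup (\<lambda>N. ereal ((v (N+1) - 1) / \<epsilon> N)) < ereal z" "ereal z < 1"
      using ereal_dense2 by blast
    \<comment> \<open>The cap 1/3 keeps \<open>1 - 3 * \<delta>\<close> nonnegative even when the
      upper limit is far below 1; only an upper bound on \<open>v\<close> is wanted here.\<close>
    define \<delta> where "\<delta> = min (1 / 3) ((1 - z) / 3)"
    have d: "\<delta> > 0" "3 * \<delta> \<le> 1" "z \<le> 1 - 3 * \<delta>" using z(2) by (auto simp: \<delta>_def min_def field_simps)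
    have v: "\<forall>\<^sub>F N in sequentially. v (N+1) \<le> 1 + (1 - 3 * \<delta>) * \<epsilon> N"
      using Limsup_lessD[OF z(1)] eventually_ge_at_top[of 2]
    proof eventually_elim
      case (elim N)
      then have e: "\<epsilon> N > 0" using eps_pos by simp
      then have "v (N+1) - 1 \<le> z * \<epsilon> N" using elim by (simp add: pos_divide_less_eq)
      also have "\<dots> \<le> (1 - 3 * \<delta>) * \<epsilon> N" using d e by (intro mult_right_mono) auto
      finally show ?case by simp
    qed
    have "\<delta> * (2 - \<alpha>) \<le> 1 * (2 - \<alpha>)" using d \<open>\<alpha> < 2\<close> by (intro mult_right_mono) auto
    moreover have "0 < \<delta> * (2 - \<alpha>)" using d \<open>\<alpha> < 2\<close> by simp
    ultimately have dc: "0 < \<delta> * (2 - \<alpha>) / 4" "\<delta> * (2 - \<alpha>) / 4 < (2 - \<alpha>) / 2" "0 < \<delta> / 4"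
      using d(1) by linarith+
    have "AE \<omega> in M. (\<lambda>N. qprob N (\<lambda>k. Us k \<omega>) (v (N+1))
        (\<lambda>x. score N x (N+1) < Max ((score N x) ` {1..N}))) \<longlonglongrightarrow> 1"
      using env count_ge[OF dc(3,1,2)]
    proof eventually_elim
      case (elim \<omega>)
      then show ?case
        by (intro environment.last_player_behind[OF _ \<open>0 \<le> \<alpha>\<close> d(1,2) _ v])
    qed
    then show "AE \<omega> in M.
          (\<forall>N\<ge>1. qprob N (\<lambda>k. Us k \<omega>) (v (N+1)) (\<lambda>x. \<not> last_wins N x)
                  \<ge> qprob N (\<lambda>k. Us k \<omega>) (v (N+1))
                      (\<lambda>x. score N x (N+1) < Max ((score N x) ` {1..N})))
        \<and> (\<lambda>N. qprob N (\<lambda>k. Us k \<omega>) (v (N+1))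
                      (\<lambda>x. score N x (N+1) < Max ((score N x) ` {1..N})))
            \<longlonglongrightarrow> 1"
    proof eventually_elim
      case (elim \<omega>)
      then show ?case by (intro conjI allI impI qprob_mono not_last_wins_if_behind)
    qed
  qed
qed

end
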